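(* Let $\alpha\in(-\infty,-3/2)\cup\big([1/2,\infty)\setminus\mathbb{N}\big)$ and $c>0$ be fixed. Then for every $1\le p\le\infty$, the cardinal interpolation operator $\mathscr{I}_{\alpha,c}$ is a bounded linear operator from $\ell_p(\mathbb{Z})$ to $L_p(\mathbb{R})$.
   Context: For $c>0$ and $\alpha\in\mathbb{R}\setminus\{0,1,2,\dots\}$, the one-dimensional general multiquadric $\phi_{\alpha,c}(x)=(x^2+c^2)^\alpha$ has generalized Fourier transform $$\widehat{\phi}_{\alpha,c}(\xi)=\frac{2^{1+\alpha}}{\Gamma(-\alpha)}\Big(\frac{c}{|\xi|}\Big)^{\alpha+\frac12}K_{\alpha+\frac12}(c|\xi|),\quad \xi\neq 0,$$ where $K_\nu=K_{-\nu}$ is the modified Bessel function of the second kind. Set $$\widehat{L}_{\alpha,c}(\xi)=\frac{\widehat{\phi}_{\alpha,c}(\xi)}{\sum_{j\in\mathbb{Z}}\widehat{\phi}_{\alpha,c}(\xi+2\pi j)},\quad\xi\in\mathbb{R}$$ (extended by continuity to $\xi\in2\pi\mathbb{Z}$). This is in $L_1(\mathbb{R})$, and the fundamental function is $L_{\alpha,c}(x)=\frac1{2\pi}\int_{\mathbb{R}}\widehat{L}_{\alpha,c}(\xi)e^{ix\xi}d\xi$. The cardinal interpolation operator acts on sequences $\mathbf{y}=(y_j)_{j\in\mathbb{Z}}$ by $\mathscr{I}_{\alpha,c}\mathbf{y}(x)=\sum_{j\in\mathbb{Z}}y_jL_{\alpha,c}(x-j)$, $x\in\mathbb{R}$. 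*)

theory Defs
  imports "HOL-Analysis.Analysis" "HOL-Probability.Essential_Supremum"
begin

(* Modified Bessel function of the second kind, of real order; meaningful for z > 0. *)
definition bessel_K :: "real \<Rightarrow> real \<Rightarrow> real" where
  "bessel_K \<nu> z = (LINT t:{0..}|lborel. exp (- z * cosh t) * cosh (\<nu> * t))"

(* The value at \<xi> = 0 is a default and plays no role below. *)
definition multiquadric_hat :: "real \<Rightarrow> real \<Rightarrow> real \<Rightarrow> real" where
  "multiquadric_hat \<alpha> c \<xi> =
     2 powr (1 + \<alpha>) / Gamma (- \<alpha>) * (c / \<bar>\<xi>\<bar>) powr (\<alpha> + 1/2) * bessel_K (\<alpha> + 1/2) (c * \<bar>\<xi>\<bar>)"

definition fundamental_quotient :: "real \<Rightarrow> real \<Rightarrow> real \<Rightarrow> real" where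
  "fundamental_quotient \<alpha> c \<xi> =
     multiquadric_hat \<alpha> c \<xi> / (\<Sum>\<^sub>\<infinity>j\<in>(UNIV :: int set). multiquadric_hat \<alpha> c (\<xi> + 2 * pi * of_int j))"

(* On the lattice of multiples of 2 pi, one summand of the denominator is evaluated at 0;
   there the quotient is replaced by its limit (extension by continuity). *)
definition fundamental_hat :: "real \<Rightarrow> real \<Rightarrow> real \<Rightarrow> real" where
  "fundamental_hat \<alpha> c \<xi> =
     (if \<exists>k::int. \<xi> = 2 * pi * of_int k then Lim (at \<xi>) (fundamental_quotient \<alpha> c)
      else fundamental_quotient \<alpha> c \<xi>)"

definition fundamental_fun :: "real \<Rightarrow> real \<Rightarrow> real \<Rightarrow> complex" where
  "fundamental_fun \<alpha> c x =
     1 / (2 * pi) * (LINT \<xi>|lborel. of_real (fundamental_hat \<alpha> c \<xi>) * exp (\<i> * of_real (x * \<xi>)))"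

definition cardinal_interpolation :: "real \<Rightarrow> real \<Rightarrow> (int \<Rightarrow> complex) \<Rightarrow> real \<Rightarrow> complex" where
  "cardinal_interpolation \<alpha> c y x =
     (\<Sum>\<^sub>\<infinity>j\<in>(UNIV :: int set). y j * fundamental_fun \<alpha> c (x - of_int j))"

(* Lp spaces for 1 \<le> p \<le> \<infinity>, as sets of representatives.  The sequence space
   over the integers is the instance M = count_space UNIV, where integrability is absolute
   summability and, since only the empty set is null, esssup is the supremum. *)
definition Lp_space :: "ennreal \<Rightarrow> 'a measure \<Rightarrow> ('a \<Rightarrow> complex) set" where
  "Lp_space p M =
     {f \<in> borel_measurable M.
        if p = \<infinity> then esssup M (\<lambda>x. ennreal (norm (f x))) < \<infinity>
        else integrable M (\<lambda>x. norm (f x) powr enn2real p)}"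

definition Lp_norm :: "ennreal \<Rightarrow> 'a measure \<Rightarrow> ('a \<Rightarrow> complex) \<Rightarrow> real" where
  "Lp_norm p M f =
     (if p = \<infinity> then enn2real (esssup M (\<lambda>x. ennreal (norm (f x))))
      else (LINT x|M. norm (f x) powr enn2real p) powr (1 / enn2real p))"

(* Linearity is required almost everywhere, as equality in Lp is equality almost everywhere.
   Compatibility with almost everywhere equality of arguments follows from
   linearity and boundedness. *)
definition bounded_linear_Lp ::
    "ennreal \<Rightarrow> 'a measure \<Rightarrow> 'b measure \<Rightarrow> (('a \<Rightarrow> complex) \<Rightarrow> 'b \<Rightarrow> complex) \<Rightarrow> bool" where
  "bounded_linear_Lp p M N T \<longleftrightarrow>
     (\<forall>f\<in>Lp_space p M. T f \<in> Lp_space p N) \<and>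
     (\<forall>f\<in>Lp_space p M. \<forall>g\<in>Lp_space p M. AE x in N. T (\<lambda>t. f t + g t) x = T f x + T g x) \<and>
     (\<forall>a. \<forall>f\<in>Lp_space p M. AE x in N. T (\<lambda>t. a * f t) x = a * T f x) \<and>
     (\<exists>C. \<forall>f\<in>Lp_space p M. Lp_norm p N (T f) \<le> C * Lp_norm p M f)"

end

theory Submission
  imports Defs "HOL-Probability.Sinc_Integral" "HOL-Real_Asymp.Real_Asymp"
begin

text \<open>
  Both operator bounds reduce to the decay \<open>|L(x)| \<le> K / (1 + x\<^sup>2)\<close> of the fundamental function:
  it makes \<open>\<Sum>j |L(x - j)|\<close> uniformly bounded and \<open>L\<close> integrable, after which Jensen's inequality
  and Tonelli's theorem give the result for all exponents at once.

  For the decay, the substitution \<open>t \<mapsto> t + ln (c / (2|\<xi>|))\<close> turns the Bessel integral into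
  \<open>M\<^sub>a(\<xi>) = \<integral> exp (a t - \<xi>\<^sup>2 e\<^sup>t - b e\<^sup>-\<^sup>t) dt\<close> with \<open>a = \<alpha> + 1/2\<close>, \<open>b = c\<^sup>2/4\<close>, for which
  \<open>M\<^sub>a' = -2 \<xi> M\<^sub>a\<^sub>+\<^sub>1\<close> and \<open>\<xi>\<^sup>2 M\<^sub>a\<^sub>+\<^sub>1 = a M\<^sub>a + b M\<^sub>a\<^sub>-\<^sub>1\<close>. These bound the first two logarithmic
  derivatives of \<open>M\<^sub>a\<close> by powers of \<open>1 + 1/|\<xi>|\<close>. The quotient \<open>u = M\<^sub>a / \<Sum>j M\<^sub>a(\<cdot> + 2\<pi>j)\<close> then has
  first and second derivatives controlled by the distance to the lattice and \<open>min u (1 - u)\<close>, and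
  two integrations by parts finish the argument. For \<open>a \<ge> 1\<close> the pole of \<open>M\<^sub>a\<close> at \<open>0\<close> makes
  \<open>min u (1 - u)\<close> vanish to second order on the lattice; for \<open>a < -1\<close> the function \<open>M\<^sub>a\<close> is
  continuously differentiable at \<open>0\<close>.
\<close>

subsection \<open>Differentiation under the integral\<close>

text \<open>Off \<open>lattice\<close> the quotient u is twice differentiable, so all difficulties
  sit on the lattice. Two integrations by parts tolerate a jump of u'' there, but not of u or u'. If
  the transform has a pole at 0, its first two logarithmic derivatives may grow like 1/d and 1/d^2
  in the distance d to the lattice. The lost factor d^2 has to be regained from min u (1 - u), which
  takes a pole of order at least two. The recurrence at order a - 1 supplies one as soon as its
  coefficient a - 1 is nonnegative, that is for \<alpha> \<ge> 1/2. If there is no pole, continuity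
  of u' on the lattice is secured by a finite moment of order a + 1 at 0, that is by a + 1 < 0, or
  \<alpha> < -3/2. All derivative estimates are relative to the function itself. Such estimates
  survive summation over the lattice with the same constant, so numerator and denominator of u are
  controlled by one inequality for the profile.\<close>

lemma tendsto_lebesgue_integral_at:
  fixes f :: "real \<Rightarrow> 'a \<Rightarrow> real"
  assumes meas: "eventually (\<lambda>y. f y \<in> borel_measurable M) (at x)" "l \<in> borel_measurable M"
    and lim: "\<And>t. t \<in> space M \<Longrightarrow> ((\<lambda>y. f y t) \<longlongrightarrow> l t) (at x)"
    and bound: "eventually (\<lambda>y. \<forall>t\<in>space M. \<bar>f y t\<bar> \<le> g t) (at x)"
    and g: "integrable M g"
  shows "((\<lambda>y. LINT t|M. f y t) \<longlongrightarrow> (LINT t|M. l t)) (at x)"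
  unfolding tendsto_at_iff_sequentially o_def
proof (intro allI impI)
  fix X :: "nat \<Rightarrow> real"
  assume X: "\<forall>i. X i \<in> UNIV - {x}" "X \<longlonglongrightarrow> x"
  then have at: "filterlim X (at x) sequentially"
    by (auto simp: filterlim_at)
  have "eventually (\<lambda>n. f (X n) \<in> borel_measurable M \<and> (\<forall>t\<in>space M. \<bar>f (X n) t\<bar> \<le> g t)) sequentially"
    using eventually_compose_filterlim[OF meas(1) at] eventually_compose_filterlim[OF bound at]
    by eventually_elim auto
  then obtain N where N: "\<And>n. n \<ge> N \<Longrightarrow>
      f (X n) \<in> borel_measurable M \<and> (\<forall>t\<in>space M. \<bar>f (X n) t\<bar> \<le> g t)"
    by (auto simp: eventually_sequentially)
  have "(\<lambda>n. LINT t|M. f (X (n + N)) t) \<longlonglongrightarrow> (LINT t|M. l t)"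
  proof (rule integral_dominated_convergence[OF meas(2) _ g])
    show "\<And>n. f (X (n + N)) \<in> borel_measurable M" using N by auto
    show "AE t in M. (\<lambda>n. f (X (n + N)) t) \<longlonglongrightarrow> l t"
      using LIMSEQ_ignore_initial_segment[OF filterlim_compose[OF lim at]] by (intro AE_I2)
    show "\<And>n. AE t in M. norm (f (X (n + N)) t) \<le> g t"
      using N by auto
  qed
  then show "(\<lambda>n. LINT t|M. f (X n) t) \<longlonglongrightarrow> (LINT t|M. l t)"
    by (rule LIMSEQ_offset)
qed

text \<open>The measure is arbitrary so that one statement covers both the Bessel integrals over
  \<open>lborel\<close> and the lattice sums, taken as integrals over a counting measure.\<close>

lemma has_real_derivative_lebesgue_integral:
  fixes f f' :: "real \<Rightarrow> 'a \<Rightarrow> real"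
  assumes "d > 0"
    and der: "\<And>y t. \<bar>y - x\<bar> < d \<Longrightarrow> t \<in> space M \<Longrightarrow> ((\<lambda>y. f y t) has_real_derivative f' y t) (at y)"
    and int: "\<And>y. \<bar>y - x\<bar> < d \<Longrightarrow> integrable M (f y)"
    and meas: "f' x \<in> borel_measurable M"
    and bound: "\<And>y t. \<bar>y - x\<bar> < d \<Longrightarrow> t \<in> space M \<Longrightarrow> \<bar>f' y t\<bar> \<le> g t"
    and g: "integrable M g"
  shows "((\<lambda>y. LINT t|M. f y t) has_real_derivative (LINT t|M. f' x t)) (at x)"
proof -
  have near: "eventually (\<lambda>y. \<bar>y - x\<bar> < d) (at x)"
    using \<open>d > 0\<close> by (auto simp: eventually_at dist_real_def)
  have "((\<lambda>y. LINT t|M. (f y t - f x t) / (y - x)) \<longlongrightarrow> (LINT t|M. f' x t)) (at x)"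
  proof (rule tendsto_lebesgue_integral_at[OF _ meas _ _ g])
    show "\<forall>\<^sub>F y in at x. (\<lambda>t. (f y t - f x t) / (y - x)) \<in> borel_measurable M"
      using near by eventually_elim (use int \<open>d > 0\<close> in \<open>auto intro!: borel_measurable_divide borel_measurable_diff\<close>)
    show "((\<lambda>y. (f y t - f x t) / (y - x)) \<longlongrightarrow> f' x t) (at x)" if "t \<in> space M" for t
      using der[of x t] that \<open>d > 0\<close> by (simp add: has_field_derivative_iff)
    show "\<forall>\<^sub>F y in at x. \<forall>t\<in>space M. \<bar>(f y t - f x t) / (y - x)\<bar> \<le> g t"
      using near
    proof eventually_elim
      case (elim y)
      show ?case
      proof
        fix t assume t: "t \<in> space M"
        \<comment> \<open>By the mean value inequality the majorant of the derivative also bounds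
          the difference quotients.\<close>
        have "norm (f y t - f x t) \<le> g t * norm (y - x)"
          by (rule field_differentiable_bound[where S = "{x - d<..<x + d}" and f' = "\<lambda>z. f' z t"])
            (use der bound t elim \<open>d > 0\<close> in \<open>auto intro: has_field_derivative_at_within simp: abs_less_iff\<close>)
        moreover have "0 \<le> g t" using bound[of x t] t \<open>d > 0\<close> by auto
        ultimately show "\<bar>(f y t - f x t) / (y - x)\<bar> \<le> g t"
          by (cases "y = x") (auto simp: abs_divide divide_le_eq)
      qed
    qed
  qed
  moreover have "\<forall>\<^sub>F y in at x. (LINT t|M. (f y t - f x t) / (y - x))
      = ((LINT t|M. f y t) - (LINT t|M. f x t)) / (y - x)"
    using near by eventually_elim (use int \<open>d > 0\<close> in \<open>auto simp: Bochner_Integration.integral_diff\<close>)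
  ultimately show ?thesis
    unfolding has_field_derivative_iff by (rule Lim_transform_eventually)
qed

lemma integrable_one_div_one_plus_square: "integrable lborel (\<lambda>x::real. 1 / (1 + x\<^sup>2))"
  using integrable_inverse_1_plus_square
  by (simp add: set_integrable_def inverse_eq_divide)

subsection \<open>Moments of the Bessel kernel\<close>

text \<open>Since \<open>x\<close> enters only through its square and the order only through
  \<open>exp (a * t)\<close>, differentiating in \<open>x\<close> raises the order. Unlike the
  formula with K, this one makes sense at x = 0 when a < 0, where the regular case evaluates
  it.\<close>

definition bessel_kernel :: "real \<Rightarrow> real \<Rightarrow> real \<Rightarrow> real \<Rightarrow> real" where
  "bessel_kernel a b x t = exp (a * t - x\<^sup>2 * exp t - b * exp (- t))"

definition bessel_mix :: "real \<Rightarrow> real \<Rightarrow> real \<Rightarrow> real" where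
  "bessel_mix a b x = (LINT t|lborel. bessel_kernel a b x t)"

lemma bessel_kernel_pos: "bessel_kernel a b x t > 0"
  by (simp add: bessel_kernel_def)

lemma bessel_kernel_add: "bessel_kernel (a + k) b x t = exp (k * t) * bessel_kernel a b x t"
  by (simp add: bessel_kernel_def exp_add[symmetric] algebra_simps)

lemma bessel_kernel_measurable [measurable]: "bessel_kernel a b x \<in> borel_measurable borel"
  unfolding bessel_kernel_def[abs_def] by measurable

text \<open>Towards \<open>at_bot\<close> the double exponential with \<open>b\<close> wins. Towards
  \<open>at_top\<close> the decay comes from \<open>exp t\<close> if x is nonzero and otherwise from
  \<open>exp (a * t)\<close> with a < 0; this is the source of the side condition carried by all the
  moments. The weight leaves an integrable majorant.\<close>

lemma bessel_kernel_tendsto: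
  assumes "b > 0" "x \<noteq> 0 \<or> a < 0"
  shows "((\<lambda>t. (1 + t\<^sup>2) * bessel_kernel a b x t) \<longlongrightarrow> 0) at_top"
    and "((\<lambda>t. (1 + t\<^sup>2) * bessel_kernel a b x t) \<longlongrightarrow> 0) at_bot"
proof -
  obtain c where c: "c = x\<^sup>2" "c \<ge> 0" by auto
  then consider "c > 0" | "c = 0" "a < 0" using assms by fastforce
  then show "((\<lambda>t. (1 + t\<^sup>2) * bessel_kernel a b x t) \<longlongrightarrow> 0) at_top"
    "((\<lambda>t. (1 + t\<^sup>2) * bessel_kernel a b x t) \<longlongrightarrow> 0) at_bot"
    unfolding bessel_kernel_def c(1)[symmetric] using \<open>b > 0\<close>
    by (cases; simp; real_asymp)+
qed

lemma bounded_of_tendsto_at_top_at_bot: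
  fixes f :: "real \<Rightarrow> real"
  assumes "continuous_on UNIV f" "(f \<longlongrightarrow> 0) at_top" "(f \<longlongrightarrow> 0) at_bot"
  obtains K where "\<And>t. \<bar>f t\<bar> \<le> K"
proof -
  obtain u where u: "\<And>t. t \<ge> u \<Longrightarrow> \<bar>f t\<bar> < 1"
    using tendstoD[OF assms(2), of 1] by (auto simp: eventually_at_top_linorder)
  obtain l where l: "\<And>t. t \<le> l \<Longrightarrow> \<bar>f t\<bar> < 1"
    using tendstoD[OF assms(3), of 1] by (auto simp: eventually_at_bot_linorder)
  have "bounded (f ` {l..u})"
    by (intro compact_imp_bounded compact_continuous_image continuous_on_subset[OF assms(1)]) auto
  then obtain B where "\<forall>t\<in>{l..u}. \<bar>f t\<bar> \<le> B"
    by (auto simp: bounded_iff)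
  then have "\<bar>f t\<bar> \<le> max 1 B" for t
    using u[of t] l[of t] by (cases "t \<le> l"; cases "t \<ge> u") (auto simp: le_max_iff_disj)
  then show ?thesis by (rule that)
qed

lemma bessel_kernel_integrable:
  assumes "b > 0" "x \<noteq> 0 \<or> a < 0"
  shows "integrable lborel (bessel_kernel a b x)"
proof -
  obtain K where K: "\<And>t. \<bar>(1 + t\<^sup>2) * bessel_kernel a b x t\<bar> \<le> K"
    by (rule bounded_of_tendsto_at_top_at_bot[OF _ bessel_kernel_tendsto[OF assms]])
      (auto simp: bessel_kernel_def intro!: continuous_intros)
  show ?thesis
  proof (rule Bochner_Integration.integrable_bound)
    show "integrable lborel (\<lambda>t. K * (1 / (1 + t\<^sup>2)))"
      by (intro integrable_mult_right integrable_one_div_one_plus_square)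
    show "AE t in lborel. norm (bessel_kernel a b x t) \<le> norm (K * (1 / (1 + t\<^sup>2)))"
    proof (rule AE_I2)
      fix t :: real
      have p: "1 + t\<^sup>2 > 0" by (simp add: add_pos_nonneg)
      have "(1 + t\<^sup>2) * bessel_kernel a b x t \<le> K" using K[of t] by simp
      then have "bessel_kernel a b x t \<le> K / (1 + t\<^sup>2)"
        using p by (simp add: pos_le_divide_eq mult.commute)
      then show "norm (bessel_kernel a b x t) \<le> norm (K * (1 / (1 + t\<^sup>2)))"
        using bessel_kernel_pos[of a b x t] by (simp del: abs_divide)
    qed
  qed simp
qed

lemma bessel_mix_pos:
  assumes "b > 0" "x \<noteq> 0 \<or> a < 0"
  shows "bessel_mix a b x > 0"
proof -
  have "bessel_mix a b x \<noteq> 0"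
  proof
    assume "bessel_mix a b x = 0"
    then have "AE t in lborel. bessel_kernel a b x t = 0"
      unfolding bessel_mix_def
      by (subst (asm) integral_nonneg_eq_0_iff_AE[OF bessel_kernel_integrable[OF assms]])
        (auto simp: less_imp_le[OF bessel_kernel_pos])
    then have "AE t in lborel :: real measure. False"
      by eventually_elim (use bessel_kernel_pos[of a b x] in \<open>auto simp: less_le\<close>)
    then show False by (simp add: eventually_False ae_filter_eq_bot_iff)
  qed
  moreover have "bessel_mix a b x \<ge> 0"
    unfolding bessel_mix_def
    by (intro Bochner_Integration.integral_nonneg) (simp add: less_imp_le[OF bessel_kernel_pos])
  ultimately show ?thesis by simp
qed

lemma bessel_kernel_antimono: "\<bar>x\<bar> \<le> \<bar>y\<bar> \<Longrightarrow> bessel_kernel a b y t \<le> bessel_kernel a b x t"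
  by (simp add: bessel_kernel_def abs_le_square_iff mult_right_mono)

lemma bessel_mix_antimono:
  assumes "b > 0" "x \<noteq> 0 \<or> a < 0" "\<bar>x\<bar> \<le> \<bar>y\<bar>"
  shows "bessel_mix a b y \<le> bessel_mix a b x"
  unfolding bessel_mix_def
  by (intro integral_mono bessel_kernel_integrable bessel_kernel_antimono) (use assms in auto)

text \<open>The condition a < -1 at x = 0 is integrability for the order a + 1, which is the order
  of the dominating function.\<close>

lemma bessel_mix_has_derivative:
  assumes "b > 0" "x \<noteq> 0 \<or> a < - 1"
  shows "(bessel_mix a b has_real_derivative - 2 * x * bessel_mix (a + 1) b x) (at x)"
proof -
  \<comment> \<open>Every y within \<open>d\<close> of x satisfies \<bar>y\<bar> \<ge>
    \<open>w\<close>, so the kernel at \<open>w\<close> dominates uniformly. At x = 0 no positive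
    lower bound exists and \<open>w\<close> has to be 0.\<close>
  define d where "d = (if x = 0 then 1 else \<bar>x\<bar> / 2)"
  define w where "w = (if x = 0 then 0 else \<bar>x\<bar> / 2)"
  have near: "w \<le> \<bar>y\<bar>" "\<bar>y\<bar> \<le> \<bar>x\<bar> + d" "y \<noteq> 0 \<or> a < -1" if "\<bar>y - x\<bar> < d" for y
    using that assms by (auto simp: d_def w_def abs_if split: if_splits)
  have w: "w \<noteq> 0 \<or> a < -1" "w \<ge> 0" "d > 0" using assms by (auto simp: w_def d_def)
  have "((\<lambda>y. LINT t|lborel. bessel_kernel a b y t) has_real_derivative
      (LINT t|lborel. - 2 * x * bessel_kernel (a + 1) b x t)) (at x)"
  proof (rule has_real_derivative_lebesgue_integral[where d = d])
    show "((\<lambda>y. bessel_kernel a b y t) has_real_derivative - 2 * y * bessel_kernel (a + 1) b y t) (at y)"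
      for y t
      unfolding bessel_kernel_add[of a 1]
      by (auto simp: bessel_kernel_def intro!: derivative_eq_intros)
    show "\<bar>- 2 * y * bessel_kernel (a + 1) b y t\<bar> \<le> 2 * (\<bar>x\<bar> + d) * bessel_kernel (a + 1) b w t"
      if "\<bar>y - x\<bar> < d" for y t
      using near[OF that] bessel_kernel_antimono[of w y "a + 1" b t] bessel_kernel_pos[of "a+1" b y t] w
      by (auto simp: abs_mult intro!: mult_mono)
    show "integrable lborel (\<lambda>t. 2 * (\<bar>x\<bar> + d) * bessel_kernel (a + 1) b w t)"
      using w assms(1) by (intro integrable_mult_right bessel_kernel_integrable) auto
    show "integrable lborel (bessel_kernel a b y)" if "\<bar>y - x\<bar> < d" for y
      using near[OF that] assms(1) by (intro bessel_kernel_integrable) auto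
  qed (use w in auto)
  then show ?thesis unfolding bessel_mix_def[abs_def] by simp
qed

text \<open>The integrand \<open>f\<close> of right side minus left side is the t-derivative of the
  kernel, which vanishes at both ends. For nonzero x this is the three-term recurrence of K.\<close>

lemma bessel_mix_recurrence:
  assumes "b > 0" "x \<noteq> 0 \<or> a < - 1"
  shows "x\<^sup>2 * bessel_mix (a + 1) b x = a * bessel_mix a b x + b * bessel_mix (a - 1) b x"
proof -
  define f where "f t = a * bessel_kernel a b x t - x\<^sup>2 * bessel_kernel (a + 1) b x t
    + b * bessel_kernel (a - 1) b x t" for t
  have int: "integrable lborel (bessel_kernel (a + k) b x)" if "k \<le> 1" for k
    using assms that by (intro bessel_kernel_integrable) auto
  have i: "integrable lborel (bessel_kernel a b x)" "integrable lborel (bessel_kernel (a+1) b x)"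
    "integrable lborel (bessel_kernel (a-1) b x)"
    using int[of 0] int[of 1] int[of "-1"] by simp_all
  have lim: "((\<lambda>t. bessel_kernel a b x t) \<longlongrightarrow> 0) F" if "F = at_top \<or> F = at_bot" for F
  proof (rule Lim_null_comparison)
    show "\<forall>\<^sub>F t in F. norm (bessel_kernel a b x t) \<le> (1 + t\<^sup>2) * bessel_kernel a b x t"
      by (rule always_eventually) (auto simp: abs_of_pos[OF bessel_kernel_pos] distrib_right
          less_imp_le[OF bessel_kernel_pos])
    show "((\<lambda>t. (1 + t\<^sup>2) * bessel_kernel a b x t) \<longlongrightarrow> 0) F"
      using bessel_kernel_tendsto[of b x a] assms that by auto
  qed
  have "(LBINT t=-\<infinity>..\<infinity>. f t) = 0 - 0"
  proof (rule interval_integral_FTC_integrable)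
    show "(bessel_kernel a b x has_vector_derivative f t) (at t)" for t
    proof -
      have "(bessel_kernel a b x has_real_derivative
          (a - x\<^sup>2 * exp t + b * exp (- t)) * bessel_kernel a b x t) (at t)"
        unfolding bessel_kernel_def by (auto intro!: derivative_eq_intros)
      moreover have "(a - x\<^sup>2 * exp t + b * exp (- t)) * bessel_kernel a b x t = f t"
        using bessel_kernel_add[of a "-1" b x t] bessel_kernel_add[of a 1 b x t]
        by (simp add: f_def algebra_simps)
      ultimately show ?thesis by (simp add: has_real_derivative_iff_has_vector_derivative)
    qed
    show "isCont f t" for t
      unfolding f_def[abs_def] bessel_kernel_def by (intro continuous_intros)
    show "set_integrable lborel (einterval (-\<infinity>) \<infinity>) f"
      unfolding set_integrable_def f_def[abs_def] using i by simp
    show "((bessel_kernel a b x \<circ> real_of_ereal) \<longlongrightarrow> 0) (at_left \<infinity>)"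
      using lim[of at_top] by (simp add: ereal_tendsto_simps)
    show "((bessel_kernel a b x \<circ> real_of_ereal) \<longlongrightarrow> 0) (at_right (-\<infinity>))"
      using lim[of at_bot] by (simp add: ereal_tendsto_simps)
  qed simp
  then have "(LINT t|lborel. f t) = 0"
    by (simp add: interval_lebesgue_integral_def set_lebesgue_integral_def)
  then show ?thesis
    unfolding f_def bessel_mix_def using i by simp
qed

text \<open>Evaluating the quadratic form \<open>\<integral> (e\<^sup>t - \<lambda>)\<^sup>2\<close> at the ratio of consecutive moments and
  eliminating the higher moment by the recurrence yields a quadratic inequality for the ratio.\<close>

lemma bessel_mix_ratio:
  assumes "b > 0" "x \<noteq> 0"
  shows "x\<^sup>2 * bessel_mix (a + 1) b x \<le> (\<bar>a + 1\<bar> + sqrt b * \<bar>x\<bar>) * bessel_mix a b x"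
proof -
  define r where "r = bessel_mix (a + 1) b x / bessel_mix a b x"
  have pos: "bessel_mix a b x > 0" "bessel_mix (a + 1) b x > 0"
    using assms by (auto intro: bessel_mix_pos)
  have r: "r > 0" "bessel_mix (a + 1) b x = r * bessel_mix a b x"
    using pos by (auto simp: r_def)
  have i: "integrable lborel (bessel_kernel k b x)" for k
    using assms by (intro bessel_kernel_integrable) auto
  have eq: "(exp t - r)\<^sup>2 * bessel_kernel a b x t =
      bessel_kernel (a + 2) b x t - 2 * r * bessel_kernel (a + 1) b x t + r\<^sup>2 * bessel_kernel a b x t" for t
    using bessel_kernel_add[of a 1 b x t] bessel_kernel_add[of a 2 b x t] exp_add[of t t]
    by (simp add: power2_eq_square algebra_simps mult_2[symmetric])
  have "0 \<le> (LINT t|lborel. (exp t - r)\<^sup>2 * bessel_kernel a b x t)"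
    by (intro Bochner_Integration.integral_nonneg) (simp add: less_imp_le[OF bessel_kernel_pos])
  also have "\<dots> = bessel_mix (a + 2) b x - 2 * r * bessel_mix (a + 1) b x + r\<^sup>2 * bessel_mix a b x"
    unfolding eq using i by (simp add: bessel_mix_def)
  finally have "r\<^sup>2 * bessel_mix a b x \<le> bessel_mix (a + 2) b x"
    unfolding r(2) by (simp add: power2_eq_square algebra_simps)
  then have "x\<^sup>2 * (r\<^sup>2 * bessel_mix a b x) \<le> x\<^sup>2 * bessel_mix (a + 1 + 1) b x"
    by (intro mult_left_mono) (auto simp: add.assoc)
  also have "\<dots> = (a + 1) * bessel_mix (a + 1) b x + b * bessel_mix a b x"
    using bessel_mix_recurrence[of b x "a + 1"] assms by simp
  also have "\<dots> = ((a + 1) * r + b) * bessel_mix a b x"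
    unfolding r(2) by (simp add: algebra_simps)
  finally have quad: "x\<^sup>2 * r\<^sup>2 \<le> (a + 1) * r + b"
    using pos(1) by (simp add: mult.assoc[symmetric])
  have "x\<^sup>2 * r \<le> \<bar>a + 1\<bar> + sqrt b * \<bar>x\<bar>"
  proof (rule ccontr)
    \<comment> \<open>This bounds r without computing the roots of the quadratic. If x^2 r were
      larger, then in particular \<bar>x\<bar> r > \<open>sqrt b\<close>, hence b \<le>
      \<open>sqrt b\<close> \<bar>x\<bar> r, and the right side of \<open>quad\<close> would fall
      below its left side.\<close>
    assume "\<not> ?thesis"
    then have c: "\<bar>a + 1\<bar> + sqrt b * \<bar>x\<bar> < \<bar>x\<bar> * (\<bar>x\<bar> * r)"
      by (simp add: power2_eq_square mult.assoc[symmetric])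
    then have "\<bar>x\<bar> * sqrt b < \<bar>x\<bar> * (\<bar>x\<bar> * r)" by (simp add: mult.commute)
    then have "sqrt b < \<bar>x\<bar> * r" using assms by simp
    then have "b \<le> sqrt b * (\<bar>x\<bar> * r)"
      using assms(1) mult_left_mono[of "sqrt b" "\<bar>x\<bar> * r" "sqrt b"] by simp
    moreover have "(a + 1) * r \<le> \<bar>a + 1\<bar> * r" using r(1) by (intro mult_right_mono) auto
    ultimately have "(a + 1) * r + b \<le> (\<bar>a + 1\<bar> + sqrt b * \<bar>x\<bar>) * r"
      by (simp add: algebra_simps)
    also have "\<dots> < \<bar>x\<bar> * (\<bar>x\<bar> * r) * r" using c r(1) by (rule mult_strict_right_mono)
    also have "\<dots> = x\<^sup>2 * r\<^sup>2" by (simp add: power2_eq_square)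
    finally show False using quad by simp
  qed
  then show ?thesis
    using pos(1) mult_right_mono[of "x\<^sup>2 * r" _ "bessel_mix a b x"] unfolding r(2)
    by (simp add: mult.assoc)
qed

section \<open>From the Bessel function and the multiquadric transform to the moments\<close>

text \<open>When both exponential coefficients equal z/2, the kernel is \<open>exp (a * t)\<close>
  times the even weight \<open>exp (- z * cosh t)\<close>. Splitting \<open>cosh (a * t)\<close> and
  reflecting one half turns the half-line integral into half of the integral over the line.\<close>

lemma bessel_K_eq_bessel_mix:
  assumes "z > 0"
  shows "bessel_K a z = bessel_mix a (z / 2) (sqrt (z / 2)) / 2"
proof -
  define k where "k = bessel_kernel a (z / 2) (sqrt (z / 2))"
  have k: "integrable lborel k"
    unfolding k_def using assms by (intro bessel_kernel_integrable) auto
  have kr: "integrable lborel (\<lambda>t. k (- t))"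
    using lborel_integrable_real_affine[OF k, of "-1" 0] by simp
  have eq: "exp (- z * cosh t) * cosh (a * t) = (k t + k (- t)) / 2" for t
  proof -
    have "k t = exp (a * t) * exp (- z * cosh t)" "k (- t) = exp (- (a * t)) * exp (- z * cosh t)"
      using assms unfolding k_def bessel_kernel_def exp_add[symmetric] by (auto simp: cosh_def algebra_simps)
    then show ?thesis by (simp add: cosh_def[of "a * t"] algebra_simps)
  qed
  have ind: "integrable lborel (\<lambda>t. indicator A t * k t)" "integrable lborel (\<lambda>t. indicator A t * k (- t))"
    if "A \<in> sets borel" for A
    using integrable_mult_indicator[OF _ k, of A] integrable_mult_indicator[OF _ kr, of A] that by simp_all
  have refl: "(LINT t|lborel. indicator {0..} t * k (- t)) = (LINT t|lborel. indicator {..0} t * k t)"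
    by (subst lborel_integral_real_affine[where c = "-1" and t = 0])
      (auto simp: indicator_def intro!: Bochner_Integration.integral_cong)
  have "bessel_K a z = (LINT t|lborel. (indicator {0..} t * k t + indicator {0..} t * k (- t)) / 2)"
    unfolding bessel_K_def set_lebesgue_integral_def eq
    by (intro Bochner_Integration.integral_cong) (auto simp: indicator_def)
  also have "\<dots> = ((LINT t|lborel. indicator {0..} t * k t) + (LINT t|lborel. indicator {..0} t * k t)) / 2"
    using ind by (simp add: refl)
  also have "(LINT t|lborel. indicator {0..} t * k t) + (LINT t|lborel. indicator {..0} t * k t)
      = (LINT t|lborel. indicator {0..} t * k t + indicator {..0} t * k t)"
    using ind by simp
  also have "\<dots> = (LINT t|lborel. k t)"
  proof (rule integral_cong_AE)
    show "AE t in lborel. indicator {0..} t * k t + indicator {..0} t * k t = k t"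
      using AE_lborel_singleton[of "0::real"] by eventually_elim (auto simp: indicator_def)
  qed (auto simp: k_def)
  finally show ?thesis by (simp add: bessel_mix_def k_def)
qed

text \<open>The prefactor is free of \<open>x\<close> and cancels in the quotient by the
  periodization, which can therefore be computed with \<open>bessel_mix\<close>.\<close>

lemma multiquadric_hat_eq_bessel_mix:
  assumes "c > 0" "x \<noteq> 0"
  shows "multiquadric_hat \<alpha> c x
    = 2 powr (1 + \<alpha>) / Gamma (- \<alpha>) * 2 powr (\<alpha> - 1 / 2) * bessel_mix (\<alpha> + 1 / 2) (c\<^sup>2 / 4) x"
proof -
  define a where "a = \<alpha> + 1 / 2"
  \<comment> \<open>This shift balances the kernel: the coefficients of \<open>exp s\<close> and
    \<open>exp (- s)\<close> both become c\<bar>x\<bar>/2, as required for K, and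
    \<open>exp (a * l)\<close> yields the power of c/\<bar>x\<bar>.\<close>
  define l where "l = ln (c / (2 * \<bar>x\<bar>))"
  have el: "exp l = c / (2 * \<bar>x\<bar>)" "exp (- l) = 2 * \<bar>x\<bar> / c"
    using assms by (auto simp: l_def exp_minus)
  have "bessel_mix a (c\<^sup>2 / 4) x = (LINT s|lborel. bessel_kernel a (c\<^sup>2 / 4) x (l + s))"
    unfolding bessel_mix_def by (subst lborel_integral_real_affine[where c = 1 and t = l]) auto
  also have "\<dots> = (LINT s|lborel. exp (a * l) * bessel_kernel a (c * \<bar>x\<bar> / 2) (sqrt (c * \<bar>x\<bar> / 2)) s)"
  proof (rule Bochner_Integration.integral_cong[OF refl])
    fix s
    have "x\<^sup>2 * exp (l + s) = c * \<bar>x\<bar> / 2 * exp s"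
    proof -
      have "x\<^sup>2 * exp (l + s) = \<bar>x\<bar> * \<bar>x\<bar> * (c / (2 * \<bar>x\<bar>)) * exp s"
        by (simp add: exp_add el power2_eq_square)
      then show ?thesis using assms by (simp del: abs_mult_self_eq)
    qed
    moreover have "c\<^sup>2 / 4 * exp (- (l + s)) = c * \<bar>x\<bar> / 2 * exp (- s)"
    proof -
      have "c\<^sup>2 / 4 * exp (- (l + s)) = c\<^sup>2 / 4 * (2 * \<bar>x\<bar> / c) * exp (- s)"
        by (simp only: minus_add_distrib exp_add el mult.assoc)
      then show ?thesis using assms by (simp add: power2_eq_square)
    qed
    ultimately show "bessel_kernel a (c\<^sup>2 / 4) x (l + s)
        = exp (a * l) * bessel_kernel a (c * \<bar>x\<bar> / 2) (sqrt (c * \<bar>x\<bar> / 2)) s"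
      using assms by (simp add: bessel_kernel_def exp_add[symmetric] algebra_simps)
  qed
  also have "\<dots> = (c / (2 * \<bar>x\<bar>)) powr a * (2 * bessel_K a (c * \<bar>x\<bar>))"
    using assms by (simp add: bessel_K_eq_bessel_mix bessel_mix_def powr_def l_def)
  also have "\<dots> = 2 powr (1 - a) * ((c / \<bar>x\<bar>) powr a * bessel_K a (c * \<bar>x\<bar>))"
    using assms by (simp add: powr_divide powr_mult powr_diff field_simps)
  finally have "2 powr (a - 1) * bessel_mix a (c\<^sup>2 / 4) x = (c / \<bar>x\<bar>) powr a * bessel_K a (c * \<bar>x\<bar>)"
    by (simp add: mult.assoc[symmetric] powr_add[symmetric])
  then show ?thesis by (simp add: multiquadric_hat_def a_def)
qed

subsection \<open>Decay of Fourier integrals\<close>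

lemma integral_one_div_one_plus_square_le:
  assumes "r \<ge> 0"
  shows "(\<lambda>t. 1 / (1 + t\<^sup>2)) integrable_on {- r..r}" "integral {- r..r} (\<lambda>t. 1 / (1 + t\<^sup>2)) \<le> pi"
proof -
  have "((\<lambda>t. 1 / (1 + t\<^sup>2)) has_integral (arctan r - arctan (- r))) {- r..r}"
  proof (rule fundamental_theorem_of_calculus)
    show "(arctan has_vector_derivative 1 / (1 + t\<^sup>2)) (at t within {- r..r})" for t
      using DERIV_arctan[of t] by (auto simp: has_real_derivative_iff_has_vector_derivative[symmetric]
          inverse_eq_divide intro: has_field_derivative_at_within)
  qed (use assms in auto)
  then show "(\<lambda>t. 1 / (1 + t\<^sup>2)) integrable_on {- r..r}" "integral {- r..r} (\<lambda>t. 1 / (1 + t\<^sup>2)) \<le> pi"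
    using arctan_ubound[of r] by (auto simp: integral_unique arctan_minus)
qed

lemma integral_one_div_one_plus_square: "(LINT t|lborel. 1 / (1 + t\<^sup>2)) = pi"
  using LBINT_inverse_1_plus_square
  by (simp add: interval_lebesgue_integral_def set_lebesgue_integral_def inverse_eq_divide)

text \<open>With \<open>F = e\<^sup>i\<^sup>x\<^sup>\<xi> (D - i x U)\<close> one has \<open>F' = e\<^sup>i\<^sup>x\<^sup>\<xi> (E + x\<^sup>2 U)\<close>, which performs both
  integrations by parts at once; the finitely many exceptional points in a bounded interval are
  harmless since \<open>F\<close> is continuous.\<close>

lemma fourier_integral_decay:
  fixes U D E :: "real \<Rightarrow> real" and Z :: "real set"
  assumes bounds: "\<And>t. \<bar>U t\<bar> \<le> K / (1 + t\<^sup>2)" "\<And>t. \<bar>D t\<bar> \<le> K / (1 + t\<^sup>2)" "\<And>t. \<bar>E t\<bar> \<le> K / (1 + t\<^sup>2)"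
    and cont: "continuous_on UNIV U" "continuous_on UNIV D"
    and der: "\<And>t. t \<notin> Z \<Longrightarrow> (U has_real_derivative D t) (at t)"
      "\<And>t. t \<notin> Z \<Longrightarrow> (D has_real_derivative E t) (at t)"
    and fin: "\<And>r. finite (Z \<inter> {- r..r})"
  shows "integrable lborel (\<lambda>t. of_real (U t) * exp (\<i> * of_real (x * t)))" (is "integrable _ ?g")
    and "cmod (LINT t|lborel. of_real (U t) * exp (\<i> * of_real (x * t))) \<le> 2 * pi * K / (1 + x\<^sup>2)"
proof -
  let ?e = "\<lambda>t. exp (\<i> * of_real (x * t))"
  have K: "K \<ge> 0" using bounds(1)[of 0] by auto
  have cg: "continuous_on A ?g" for A
    by (intro continuous_intros continuous_on_subset[OF cont(1)]) auto
  have g: "?g \<in> borel_measurable borel"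
    by (rule borel_measurable_continuous_onI[OF cg])
  have gb: "cmod (?g t) \<le> K / (1 + t\<^sup>2)" for t
    using bounds(1)[of t] by (simp add: norm_mult)
  have Ki: "integrable lborel (\<lambda>t. K * (1 / (1 + t\<^sup>2)))"
    by (intro integrable_mult_right integrable_one_div_one_plus_square)
  show gi: "integrable lborel ?g"
    by (rule Bochner_Integration.integrable_bound[OF Ki])
      (use g gb K in \<open>auto intro!: AE_I2 simp del: of_real_mult simp: add_pos_nonneg\<close>)
  let ?I = "LINT t|lborel. ?g t"
  \<comment> \<open>This bound serves small \<open>x\<close>. Added to the bound for
    \<open>x\<^sup>2 * cmod ?I\<close> at the end it produces the factor 1 + x^2.\<close>
  have "cmod ?I \<le> (LINT t|lborel. K * (1 / (1 + t\<^sup>2)))"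
    by (rule Bochner_Integration.integral_norm_bound_integral[OF gi Ki]) (use gb in simp)
  also have "\<dots> = pi * K" by (simp add: integral_one_div_one_plus_square del: times_divide_eq_right)
  finally have b1: "cmod ?I \<le> pi * K" .
  define F where "F t = ?e t * (of_real (D t) - \<i> * of_real x * of_real (U t))" for t
  have F_bound: "cmod (F t) \<le> (1 + \<bar>x\<bar>) * (K / (1 + t\<^sup>2))" for t
  proof -
    have "cmod (F t) \<le> \<bar>D t\<bar> + \<bar>x\<bar> * \<bar>U t\<bar>"
      unfolding F_def norm_mult using norm_triangle_ineq4[of "of_real (D t)" "\<i> * of_real x * of_real (U t)"]
      by (simp add: norm_mult)
    also have "\<dots> \<le> K / (1 + t\<^sup>2) + \<bar>x\<bar> * (K / (1 + t\<^sup>2))"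
      using bounds[of t] by (intro add_mono mult_left_mono) auto
    finally show ?thesis by (simp add: algebra_simps add_divide_distrib)
  qed
  \<comment> \<open>The gauge integral fits here because nothing is known about measurability of
    \<open>E\<close>: integrability of the term with \<open>E\<close> on the interval comes out of
    the fundamental theorem itself.\<close>
  have step: "x\<^sup>2 * cmod (integral {- r..r} ?g) \<le> pi * K + 2 * ((1 + \<bar>x\<bar>) * (K / (1 + r\<^sup>2)))"
    if "r \<ge> 0" for r
  proof -
    have "((\<lambda>t. ?e t * (of_real (E t) + of_real (x\<^sup>2 * U t))) has_integral (F r - F (- r))) {- r..r}"
    proof (rule fundamental_theorem_of_calculus_interior_strong[OF fin[of r]])
      show "continuous_on {- r..r} F"
        unfolding F_def
        by (intro continuous_intros continuous_on_subset[OF cont(1)] continuous_on_subset[OF cont(2)]) auto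
      fix t assume "t \<in> {- r<..<r} - Z \<inter> {- r..r}"
      then have t: "t \<notin> Z" by auto
      have d: "((\<lambda>t. of_real (U t)) has_vector_derivative of_real (D t)) (at t)"
        "((\<lambda>t. of_real (D t) :: complex) has_vector_derivative of_real (E t)) (at t)"
        using der[OF t] by (auto intro!: has_vector_derivative_of_real
            simp: has_real_derivative_iff_has_vector_derivative)
      have e: "(?e has_vector_derivative (\<i> * of_real x * ?e t)) (at t)"
      proof -
        have "((\<lambda>t. x * t) has_real_derivative x) (at t)"
          by (rule DERIV_cmult_Id)
        then have "((\<lambda>t. \<i> * of_real (x * t)) has_vector_derivative \<i> * of_real x) (at t)"
          by (intro has_vector_derivative_mult_right has_vector_derivative_of_real)
        from field_vector_diff_chain_at[OF this DERIV_exp] show ?thesis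
          by (simp add: o_def)
      qed
      show "(F has_vector_derivative ?e t * (of_real (E t) + of_real (x\<^sup>2 * U t))) (at t)"
        unfolding F_def
        by (rule has_vector_derivative_eq_rhs[OF has_vector_derivative_mult[OF e
              has_vector_derivative_diff[OF d(2) has_vector_derivative_mult_right[OF d(1)]]]])
          (simp add: algebra_simps power2_eq_square)
    qed (use that in auto)
    moreover have gint: "(?g has_integral integral {- r..r} ?g) {- r..r}"
      using integrable_continuous_interval[OF cg] by blast
    ultimately have "((\<lambda>t. ?e t * (of_real (E t) + of_real (x\<^sup>2 * U t)) - of_real (x\<^sup>2) * ?g t) has_integral
        (F r - F (- r) - of_real (x\<^sup>2) * integral {- r..r} ?g)) {- r..r}"
      by (intro has_integral_diff has_integral_mult_right)
    then have Ei: "((\<lambda>t. ?e t * of_real (E t)) has_integral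
        (F r - F (- r) - of_real (x\<^sup>2) * integral {- r..r} ?g)) {- r..r}"
      by (simp add: algebra_simps)
    have "cmod (integral {- r..r} (\<lambda>t. ?e t * of_real (E t))) \<le> integral {- r..r} (\<lambda>t. K * (1 / (1 + t\<^sup>2)))"
    proof (rule integral_norm_bound_integral)
      show "(\<lambda>t. ?e t * of_real (E t)) integrable_on {- r..r}" using Ei by blast
      show "(\<lambda>t. K * (1 / (1 + t\<^sup>2))) integrable_on {- r..r}"
        using integral_one_div_one_plus_square_le[OF that] by (intro integrable_on_mult_right)
      show "cmod (?e t * of_real (E t)) \<le> K * (1 / (1 + t\<^sup>2))" for t
        using bounds(3)[of t] by (simp add: norm_mult)
    qed
    also have "\<dots> \<le> K * pi"
      unfolding integral_mult_right using integral_one_div_one_plus_square_le[OF that] K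
      by (intro mult_left_mono) auto
    finally have "cmod (F r - F (- r) - of_real (x\<^sup>2) * integral {- r..r} ?g) \<le> pi * K"
      using integral_unique[OF Ei] by (simp add: mult.commute)
    moreover have "cmod (of_real (x\<^sup>2) * integral {- r..r} ?g) \<le>
        cmod (F r - F (- r) - of_real (x\<^sup>2) * integral {- r..r} ?g) + cmod (F r - F (- r))"
      using norm_triangle_ineq4[of "F r - F (- r)"
          "F r - F (- r) - of_real (x\<^sup>2) * integral {- r..r} ?g"] by simp
    moreover have "cmod (F r - F (- r)) \<le> 2 * ((1 + \<bar>x\<bar>) * (K / (1 + r\<^sup>2)))"
    proof -
      have "cmod (F r - F (- r)) \<le> cmod (F r) + cmod (F (- r))" by (rule norm_triangle_ineq4)
      also have "\<dots> \<le> (1 + \<bar>x\<bar>) * (K / (1 + r\<^sup>2)) + (1 + \<bar>x\<bar>) * (K / (1 + r\<^sup>2))"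
        using F_bound[of r] F_bound[of "- r"] by (intro add_mono) auto
      finally show ?thesis by (simp only: mult_2)
    qed
    moreover have "cmod (of_real (x\<^sup>2) * integral {- r..r} ?g) = x\<^sup>2 * cmod (integral {- r..r} ?g)"
      by (simp only: norm_mult norm_of_real abs_power2)
    ultimately show ?thesis by linarith
  qed
  have "(\<lambda>n. LINT t|lborel. indicator {- real n..real n} t *\<^sub>R ?g t) \<longlonglongrightarrow> ?I"
  proof (rule integral_dominated_convergence[OF _ _ Ki])
    show "AE t in lborel. (\<lambda>n. indicator {- real n..real n} t *\<^sub>R ?g t) \<longlonglongrightarrow> ?g t"
    proof (rule AE_I2, rule tendsto_eventually)
      fix t :: real
      obtain N where "\<bar>t\<bar> \<le> real N" using real_arch_simple by blast
      then show "\<forall>\<^sub>F n in sequentially. indicator {- real n..real n} t *\<^sub>R ?g t = ?g t"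
        by (intro eventually_sequentiallyI[of N]) (auto simp: indicator_def)
    qed
    show "AE t in lborel. norm (indicator {- real n..real n} t *\<^sub>R ?g t) \<le> K * (1 / (1 + t\<^sup>2))" for n
    proof (rule AE_I2)
      fix t :: real
      show "norm (indicator {- real n..real n} t *\<^sub>R ?g t) \<le> K * (1 / (1 + t\<^sup>2))"
        using gb[of t] K by (auto simp: indicator_def)
    qed
  qed (use g in auto)
  also have "(\<lambda>n. LINT t|lborel. indicator {- real n..real n} t *\<^sub>R ?g t) = (\<lambda>n. integral {- real n..real n} ?g)"
  proof
    fix n
    have "set_integrable lborel {- real n..real n} ?g"
      unfolding set_integrable_def by (intro integrable_mult_indicator gi) auto
    from set_borel_integral_eq_integral(2)[OF this]
    show "(LINT t|lborel. indicator {- real n..real n} t *\<^sub>R ?g t) = integral {- real n..real n} ?g"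
      by (simp add: set_lebesgue_integral_def)
  qed
  finally have lim: "(\<lambda>n. x\<^sup>2 * cmod (integral {- real n..real n} ?g)) \<longlonglongrightarrow> x\<^sup>2 * cmod ?I"
    by (intro tendsto_intros)
  \<comment> \<open>For fixed \<open>x\<close> the boundary terms vanish as the interval
    grows.\<close>
  have "(\<lambda>n. pi * K + 2 * ((1 + \<bar>x\<bar>) * (K / (1 + (real n)\<^sup>2)))) \<longlonglongrightarrow> pi * K + 2 * ((1 + \<bar>x\<bar>) * 0)"
  proof (intro tendsto_intros)
    show "(\<lambda>n. K / (1 + (real n)\<^sup>2)) \<longlonglongrightarrow> 0" by real_asymp
  qed
  then have "x\<^sup>2 * cmod ?I \<le> pi * K"
    using tendsto_le[OF _ _ lim] step by (auto intro: always_eventually)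
  then have "cmod ?I * (1 + x\<^sup>2) \<le> 2 * pi * K" using b1 by (simp add: algebra_simps)
  then show "cmod ?I \<le> 2 * pi * K / (1 + x\<^sup>2)" by (simp add: pos_le_divide_eq add_pos_nonneg)
qed

subsection \<open>Periodization\<close>

lemma integrable_count_space_int_one_div_one_plus_square:
  "integrable (count_space A) (\<lambda>j::int. 1 / (1 + (of_int j)\<^sup>2) :: real)"
proof -
  have n: "(\<lambda>n. 1 / (1 + (of_int (int n))\<^sup>2) :: real) summable_on UNIV"
  proof (rule norm_summable_imp_summable_on, rule summable_comparison_test)
    show "\<exists>N. \<forall>n\<ge>N. norm (norm (1 / (1 + (of_int (int n))\<^sup>2) :: real)) \<le> 1 / (real n)\<^sup>2"
      by (intro exI[of _ 1]) (auto intro!: divide_left_mono simp: add_pos_nonneg)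
    show "summable (\<lambda>n. 1 / (real n)\<^sup>2)"
      using inverse_power_summable[of 2, where 'a = real] by (simp add: inverse_eq_divide)
  qed
  then have "(\<lambda>n. 1 / (1 + (of_int (- int n))\<^sup>2) :: real) summable_on UNIV" by simp
  with n have "(\<lambda>j::int. 1 / (1 + (of_int j)\<^sup>2) :: real) summable_on range int"
    "(\<lambda>j::int. 1 / (1 + (of_int j)\<^sup>2) :: real) summable_on range (\<lambda>n. - int n)"
    by (subst summable_on_reindex; auto simp: o_def inj_on_def)+
  then have "(\<lambda>j::int. 1 / (1 + (of_int j)\<^sup>2) :: real) summable_on (range int \<union> range (\<lambda>n. - int n))"
    by (rule summable_on_union)
  moreover have "A \<subseteq> range int \<union> range (\<lambda>n. - int n)"
  proof
    fix j :: int
    show "j \<in> range int \<union> range (\<lambda>n. - int n)" by (cases j rule: int_cases2) auto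
  qed
  ultimately have "(\<lambda>j::int. 1 / (1 + (of_int j)\<^sup>2) :: real) summable_on A"
    by (rule summable_on_subset_banach)
  then have "Infinite_Sum.abs_summable_on (\<lambda>j::int. 1 / (1 + (of_int j)\<^sup>2) :: real) A"
    by simp
  then show ?thesis
    by (simp only: abs_summable_equivalent abs_summable_on_def)
qed

text \<open>Peetre's inequality. It dominates the translates, uniformly for x in a bounded set, by
  one summable sequence in j.\<close>

lemma one_div_one_plus_square_shift:
  "1 / (1 + (x + of_int j)\<^sup>2) \<le> 2 * (1 + x\<^sup>2) * (1 / (1 + (of_int j)\<^sup>2))" for x :: real
proof -
  define y where "y = x + of_int j"
  have j: "of_int j = y - x" by (simp add: y_def)
  have "(1 + (y - x)\<^sup>2) \<le> 2 * (1 + x\<^sup>2) * (1 + y\<^sup>2)"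
  proof -
    have "2 * (1 + x\<^sup>2) * (1 + y\<^sup>2) - (1 + (y - x)\<^sup>2) = 1 + (x + y)\<^sup>2 + 2 * (x * y)\<^sup>2"
      by (simp add: power2_eq_square algebra_simps)
    moreover have "\<dots> \<ge> 0" by simp
    ultimately show ?thesis by linarith
  qed
  then show ?thesis
    unfolding j y_def[symmetric] by (simp add: divide_le_eq pos_le_divide_eq add_pos_nonneg mult.assoc)
qed

lemma one_div_one_plus_square_shift_2pi:
  "1 / (1 + (x + 2 * pi * of_int j)\<^sup>2) \<le> 2 * (1 + x\<^sup>2) * (1 / (1 + (of_int j)\<^sup>2))" for x :: real
proof -
  define y where "y = x / (2 * pi)"
  have tp: "2 * pi \<ge> 1" using pi_ge_two by simp
  have xy: "x + 2 * pi * of_int j = 2 * pi * (y + of_int j)" "x = 2 * pi * y"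
    by (auto simp: y_def distrib_left)
  have sq: "t\<^sup>2 \<le> (2 * pi * t)\<^sup>2" for t
    using tp by (simp add: abs_le_square_iff[symmetric] abs_mult mult_le_cancel_right1)
  have "1 / (1 + (x + 2 * pi * of_int j)\<^sup>2) \<le> 1 / (1 + (y + of_int j)\<^sup>2)"
    unfolding xy(1)
    by (intro divide_left_mono mult_pos_pos add_pos_nonneg add_left_mono sq) simp_all
  also have "\<dots> \<le> 2 * (1 + y\<^sup>2) * (1 / (1 + (of_int j)\<^sup>2))" by (rule one_div_one_plus_square_shift)
  also have "\<dots> \<le> 2 * (1 + x\<^sup>2) * (1 / (1 + (of_int j)\<^sup>2))"
    using sq[of y] unfolding xy(2) by (intro mult_right_mono) auto
  finally show ?thesis .
qed

text \<open>The sum is an integral over a counting measure so that dominated convergence applies.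
  The index set is a parameter because a single term, its complement and the full sum obey the same
  estimates.\<close>

definition periodization :: "int set \<Rightarrow> (real \<Rightarrow> real) \<Rightarrow> real \<Rightarrow> real" where
  "periodization J f x = (LINT j|count_space J. f (x + 2 * pi * of_int j))"

lemma periodization_integrable:
  assumes "\<And>j. j \<in> J \<Longrightarrow> \<bar>f (x + 2 * pi * of_int j)\<bar> \<le> B / (1 + (x + 2 * pi * of_int j)\<^sup>2)"
  shows "integrable (count_space J) (\<lambda>j. f (x + 2 * pi * of_int j))"
proof (rule Bochner_Integration.integrable_bound)
  show "integrable (count_space J) (\<lambda>j. \<bar>B\<bar> * (2 * (1 + x\<^sup>2) * (1 / (1 + (of_int j)\<^sup>2))))"
    by (intro integrable_mult_right integrable_count_space_int_one_div_one_plus_square)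
  show "AE j in count_space J. norm (f (x + 2 * pi * of_int j))
      \<le> norm (\<bar>B\<bar> * (2 * (1 + x\<^sup>2) * (1 / (1 + (of_int j)\<^sup>2))))"
  proof (rule AE_I2)
    fix j assume "j \<in> space (count_space J)"
    then have "norm (f (x + 2 * pi * of_int j)) \<le> B * (1 / (1 + (x + 2 * pi * of_int j)\<^sup>2))"
      using assms by simp
    also have "\<dots> \<le> \<bar>B\<bar> * (1 / (1 + (x + 2 * pi * of_int j)\<^sup>2))" by (intro mult_right_mono) auto
    also have "\<dots> \<le> \<bar>B\<bar> * (2 * (1 + x\<^sup>2) * (1 / (1 + (of_int j)\<^sup>2)))"
      by (intro mult_left_mono one_div_one_plus_square_shift_2pi) auto
    finally show "norm (f (x + 2 * pi * of_int j)) \<le> norm (\<bar>B\<bar> * (2 * (1 + x\<^sup>2) * (1 / (1 + (of_int j)\<^sup>2))))"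
      by simp
  qed
qed simp

lemma one_plus_square_mono: "\<bar>y - x\<bar> < d \<Longrightarrow> 1 + y\<^sup>2 \<le> 1 + (\<bar>x\<bar> + d)\<^sup>2" for x y :: real
  by (simp add: abs_le_square_iff[symmetric])

lemma periodization_dominated:
  assumes "\<bar>y - x\<bar> < d" "\<bar>f (y + 2 * pi * of_int j)\<bar> \<le> B / (1 + (y + 2 * pi * of_int j)\<^sup>2)" "B \<ge> 0"
  shows "\<bar>f (y + 2 * pi * of_int j)\<bar> \<le> B * (2 * (1 + (\<bar>x\<bar> + d)\<^sup>2) * (1 / (1 + (of_int j)\<^sup>2)))"
proof -
  have "\<bar>f (y + 2 * pi * of_int j)\<bar> \<le> B * (1 / (1 + (y + 2 * pi * of_int j)\<^sup>2))"
    using assms by simp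
  also have "\<dots> \<le> B * (2 * (1 + y\<^sup>2) * (1 / (1 + (of_int j)\<^sup>2)))"
    by (intro mult_left_mono one_div_one_plus_square_shift_2pi assms)
  also have "\<dots> \<le> B * (2 * (1 + (\<bar>x\<bar> + d)\<^sup>2) * (1 / (1 + (of_int j)\<^sup>2)))"
    using one_plus_square_mono[OF assms(1)] assms(3)
    by (intro mult_left_mono mult_right_mono) auto
  finally show ?thesis .
qed

text \<open>Differentiability and decay are asked for only on lattice translates of a ball about x,
  since the profile may have a pole at 0; for x off the lattice a small enough ball avoids
  it.\<close>

lemma periodization_has_derivative:
  assumes "d > 0" "B \<ge> 0"
    and "\<And>y j. \<bar>y - x\<bar> < d \<Longrightarrow> (f has_real_derivative f' (y + 2 * pi * of_int j)) (at (y + 2 * pi * of_int j))"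
    and "\<And>y j. \<bar>y - x\<bar> < d \<Longrightarrow> \<bar>f (y + 2 * pi * of_int j)\<bar> \<le> B / (1 + (y + 2 * pi * of_int j)\<^sup>2)"
    and "\<And>y j. \<bar>y - x\<bar> < d \<Longrightarrow> \<bar>f' (y + 2 * pi * of_int j)\<bar> \<le> B / (1 + (y + 2 * pi * of_int j)\<^sup>2)"
  shows "(periodization J f has_real_derivative periodization J f' x) (at x)"
  unfolding periodization_def[abs_def]
proof (rule has_real_derivative_lebesgue_integral[OF assms(1)])
  show "((\<lambda>y. f (y + 2 * pi * of_int j)) has_real_derivative f' (y + 2 * pi * of_int j)) (at y)"
    if "\<bar>y - x\<bar> < d" for y j
    using assms(3)[OF that] by (simp add: DERIV_shift)
  show "integrable (count_space J) (\<lambda>j. f (y + 2 * pi * of_int j))" if "\<bar>y - x\<bar> < d" for y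
    using assms(4)[OF that] by (rule periodization_integrable)
  show "\<bar>f' (y + 2 * pi * of_int j)\<bar> \<le> B * (2 * (1 + (\<bar>x\<bar> + d)\<^sup>2) * (1 / (1 + (of_int j)\<^sup>2)))"
    if "\<bar>y - x\<bar> < d" for y j
    using periodization_dominated[where f = f' and y = y, OF that assms(5)[OF that] assms(2)] .
  show "integrable (count_space J) (\<lambda>j. B * (2 * (1 + (\<bar>x\<bar> + d)\<^sup>2) * (1 / (1 + (of_int j)\<^sup>2))))"
    by (intro integrable_mult_right integrable_count_space_int_one_div_one_plus_square)
qed simp

lemma periodization_isCont:
  assumes "B \<ge> 0" "\<And>y. isCont f y" "\<And>y. \<bar>f y\<bar> \<le> B / (1 + y\<^sup>2)"
  shows "isCont (periodization J f) x"
  unfolding isCont_def periodization_def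
proof (rule tendsto_lebesgue_integral_at)
  show "(\<lambda>y. f (y + 2 * pi * of_int j)) \<midarrow>x\<rightarrow> f (x + 2 * pi * of_int j)" for j
    by (rule isCont_tendsto_compose[OF assms(2)]) (intro tendsto_intros)
  have near: "eventually (\<lambda>y. \<bar>y - x\<bar> < 1) (at x)"
    by (auto simp: eventually_at dist_real_def intro: exI[of _ 1])
  show "\<forall>\<^sub>F y in at x. \<forall>j\<in>space (count_space J).
      \<bar>f (y + 2 * pi * of_int j)\<bar> \<le> B * (2 * (1 + (\<bar>x\<bar> + 1)\<^sup>2) * (1 / (1 + (of_int j)\<^sup>2)))"
    using near by eventually_elim (use periodization_dominated[where f = f, OF _ assms(3,1)] in blast)
  show "integrable (count_space J) (\<lambda>j. B * (2 * (1 + (\<bar>x\<bar> + 1)\<^sup>2) * (1 / (1 + (of_int j)\<^sup>2))))"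
    by (intro integrable_mult_right integrable_count_space_int_one_div_one_plus_square)
qed auto

section \<open>Distance to the lattice of multiples of 2 pi\<close>

definition nearest_index :: "real \<Rightarrow> int" where
  "nearest_index x = round (x / (2 * pi))"

definition lattice_dist :: "real \<Rightarrow> real" where
  "lattice_dist x = \<bar>x - 2 * pi * of_int (nearest_index x)\<bar>"

definition lattice :: "real set" where
  "lattice = range (\<lambda>k::int. 2 * pi * of_int k)"

lemma lattice_dist_le_pi: "lattice_dist x \<le> pi"
proof -
  have "\<bar>of_int (round (x / (2 * pi))) - x / (2 * pi)\<bar> \<le> 1 / 2" by (rule of_int_round_abs_le)
  then have "2 * pi * \<bar>x / (2 * pi) - of_int (round (x / (2 * pi)))\<bar> \<le> 2 * pi * (1 / 2)"
    by (intro mult_left_mono) (auto simp: abs_minus_commute)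
  also have "2 * pi * \<bar>x / (2 * pi) - of_int (round (x / (2 * pi)))\<bar>
      = \<bar>2 * pi * (x / (2 * pi) - of_int (round (x / (2 * pi))))\<bar>"
    by (simp add: abs_mult)
  also have "\<dots> = lattice_dist x"
    by (simp add: lattice_dist_def nearest_index_def right_diff_distrib)
  finally show ?thesis by simp
qed

lemma pi_le_shift:
  assumes "\<bar>y\<bar> \<le> pi" "k \<noteq> 0"
  shows "pi \<le> \<bar>y + 2 * pi * of_int k\<bar>"
proof -
  have "1 \<le> \<bar>real_of_int k\<bar>" using assms(2) by linarith
  then have "2 * pi * 1 \<le> 2 * pi * \<bar>of_int k\<bar>" by (intro mult_left_mono) auto
  also have "\<dots> = \<bar>2 * pi * of_int k\<bar>" by (simp add: abs_mult)
  finally show ?thesis using assms(1) by linarith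
qed

text \<open>The lattice point selected by rounding is at most pi away, and every other one at least
  pi.\<close>

lemma lattice_dist_le: "lattice_dist x \<le> \<bar>x + 2 * pi * of_int j\<bar>"
proof (cases "j = - nearest_index x")
  case False
  have "pi \<le> \<bar>(x - 2 * pi * of_int (nearest_index x)) + 2 * pi * of_int (j + nearest_index x)\<bar>"
    using lattice_dist_le_pi[of x] False by (intro pi_le_shift) (auto simp: lattice_dist_def)
  then show ?thesis using lattice_dist_le_pi[of x] by (simp add: algebra_simps)
qed (simp add: lattice_dist_def)

lemma lattice_dist_pos: "x \<notin> lattice \<Longrightarrow> lattice_dist x > 0"
  by (auto simp: lattice_dist_def lattice_def)

lemma shift_lattice: "x \<notin> lattice \<Longrightarrow> x + 2 * pi * of_int j \<noteq> 0"
  using lattice_dist_le[of x j] lattice_dist_pos[of x] by auto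

lemma finite_lattice_Icc: "finite (lattice \<inter> {- r..r})"
proof (rule finite_subset)
  show "lattice \<inter> {- r..r} \<subseteq> (\<lambda>k::int. 2 * pi * of_int k) ` {- \<lceil>r\<rceil>..\<lceil>r\<rceil>}"
  proof
    fix t assume "t \<in> lattice \<inter> {- r..r}"
    then obtain k :: int where k: "t = 2 * pi * of_int k" "\<bar>2 * pi * of_int k\<bar> \<le> r"
      by (auto simp: lattice_def)
    have "1 * \<bar>real_of_int k\<bar> \<le> 2 * pi * \<bar>of_int k\<bar>"
      using pi_ge_two by (intro mult_right_mono) auto
    also have "\<dots> \<le> r" using k(2) by (simp add: abs_mult)
    finally have "\<bar>real_of_int k\<bar> \<le> r" by simp
    then have "k \<in> {- \<lceil>r\<rceil>..\<lceil>r\<rceil>}" by simp linarith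
    then show "t \<in> (\<lambda>k::int. 2 * pi * of_int k) ` {- \<lceil>r\<rceil>..\<lceil>r\<rceil>}" using k(1) by blast
  qed
qed simp

text \<open>A bound of g by a multiple of f passes to sums over any index set with the same
  constant. This is how logarithmic derivative bounds reach numerator and denominator of the
  quotient.\<close>

lemma periodization_abs_le:
  assumes "\<And>j. j \<in> J \<Longrightarrow> \<bar>g (x + 2 * pi * of_int j)\<bar> \<le> k * f (x + 2 * pi * of_int j)"
    and "integrable (count_space J) (\<lambda>j. f (x + 2 * pi * of_int j))"
    and "integrable (count_space J) (\<lambda>j. g (x + 2 * pi * of_int j))"
  shows "\<bar>periodization J g x\<bar> \<le> k * periodization J f x"
proof -
  have "norm (periodization J g x) \<le> (LINT j|count_space J. norm (g (x + 2 * pi * of_int j)))"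
    unfolding periodization_def by (rule integral_norm_bound)
  also have "\<dots> \<le> (LINT j|count_space J. k * f (x + 2 * pi * of_int j))"
    by (rule integral_mono) (use assms in auto)
  finally have "norm (periodization J g x) \<le> (LINT j|count_space J. k * f (x + 2 * pi * of_int j))" .
  then show ?thesis by (simp add: periodization_def)
qed

lemma periodization_split:
  assumes "integrable (count_space UNIV) (\<lambda>j. f (x + 2 * pi * of_int j))"
  shows "periodization UNIV f x = periodization J f x + periodization (- J) f x"
proof -
  have *: "Infinite_Set_Sum.abs_summable_on (\<lambda>j. f (x + 2 * pi * of_int j)) UNIV"
    using assms by (simp add: abs_summable_on_def)
  have "infsetsum (\<lambda>j. f (x + 2 * pi * of_int j)) (J \<union> - J) =
      infsetsum (\<lambda>j. f (x + 2 * pi * of_int j)) J + infsetsum (\<lambda>j. f (x + 2 * pi * of_int j)) (- J)"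
    by (intro infsetsum_Un_disjoint Infinite_Set_Sum.abs_summable_on_subset[OF *]) auto
  then show ?thesis by (simp add: periodization_def infsetsum_def)
qed

lemma periodization_singleton: "periodization {j} f x = f (x + 2 * pi * of_int j)"
  by (simp add: periodization_def lebesgue_integral_count_space_finite)

lemma periodization_nonneg:
  "(\<And>j. j \<in> J \<Longrightarrow> f (x + 2 * pi * of_int j) \<ge> 0) \<Longrightarrow> periodization J f x \<ge> 0"
  unfolding periodization_def by (rule Bochner_Integration.integral_nonneg) simp

subsection \<open>Quotients of a profile by its periodization\<close>

text \<open>The fraction of the lattice sum contributed by \<open>J\<close>. The quotient u is the
  case \<open>{0}\<close>, and 1 - u is the case of its complement, so both are covered by the same
  estimates.\<close>

definition share :: "(real \<Rightarrow> real) \<Rightarrow> int set \<Rightarrow> real \<Rightarrow> real" where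
  "share f J x = periodization J f x / periodization UNIV f x"

text \<open>This and \<open>share''\<close> are the quotient rule applied formally, arranged as
  polynomials in ratios to the full sum so that relative bounds can be inserted term by
  term.\<close>

definition share' :: "(real \<Rightarrow> real) \<Rightarrow> (real \<Rightarrow> real) \<Rightarrow> int set \<Rightarrow> real \<Rightarrow> real" where
  "share' f f1 J x = periodization J f1 x / periodization UNIV f x
    - share f J x * (periodization UNIV f1 x / periodization UNIV f x)"

definition share'' :: "(real \<Rightarrow> real) \<Rightarrow> (real \<Rightarrow> real) \<Rightarrow> (real \<Rightarrow> real) \<Rightarrow> int set \<Rightarrow> real \<Rightarrow> real" where
  "share'' f f1 f2 J x = periodization J f2 x / periodization UNIV f x
    - 2 * (periodization J f1 x / periodization UNIV f x) * (periodization UNIV f1 x / periodization UNIV f x)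
    - share f J x * (periodization UNIV f2 x / periodization UNIV f x)
    + 2 * share f J x * (periodization UNIV f1 x / periodization UNIV f x)\<^sup>2"

text \<open>Every term retains a factor summed over \<open>J\<close> only. The bound is thus a
  multiple of \<open>share f J x\<close> and inherits both its decay at infinity and its smallness
  near the lattice.\<close>

lemma share'_bound:
  assumes S: "periodization UNIV f x > 0" and R: "periodization J f x \<ge> 0"
    and b: "\<And>J. \<bar>periodization J f1 x\<bar> \<le> k * periodization J f x"
  shows "\<bar>share' f f1 J x\<bar> \<le> 2 * k * share f J x"
proof -
  define r where "r = share f J x"
  define r1 where "r1 = periodization J f1 x / periodization UNIV f x"
  define s1 where "s1 = periodization UNIV f1 x / periodization UNIV f x"
  have r0: "r \<ge> 0" using S R by (simp add: r_def share_def)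
  have r: "\<bar>r1\<bar> \<le> k * r" using divide_right_mono[OF b[of J], of "periodization UNIV f x"] S
    by (simp add: r1_def r_def share_def)
  have "\<bar>s1\<bar> \<le> k" using divide_right_mono[OF b[of UNIV], of "periodization UNIV f x"] S
    by (simp add: s1_def)
  then have "\<bar>r * s1\<bar> \<le> r * k" unfolding abs_mult using r0 by (simp add: mult_left_mono)
  with r have "\<bar>r1 - r * s1\<bar> \<le> k * r + r * k" using abs_triangle_ineq4[of r1 "r * s1"] by linarith
  then show ?thesis unfolding share'_def r_def r1_def s1_def by (simp add: algebra_simps)
qed

lemma share''_bound:
  assumes S: "periodization UNIV f x > 0" and R: "periodization J f x \<ge> 0" and "k \<ge> 0"
    and b: "\<And>J. \<bar>periodization J f1 x\<bar> \<le> k * periodization J f x"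
    and b2: "\<And>J. \<bar>periodization J f2 x\<bar> \<le> k\<^sup>2 * periodization J f x"
  shows "\<bar>share'' f f1 f2 J x\<bar> \<le> 6 * k\<^sup>2 * share f J x"
proof -
  define r where "r = share f J x"
  define r1 where "r1 = periodization J f1 x / periodization UNIV f x"
  define r2 where "r2 = periodization J f2 x / periodization UNIV f x"
  define s1 where "s1 = periodization UNIV f1 x / periodization UNIV f x"
  define s2 where "s2 = periodization UNIV f2 x / periodization UNIV f x"
  have r0: "r \<ge> 0" using S R by (simp add: r_def share_def)
  have r1: "\<bar>r1\<bar> \<le> k * r" using divide_right_mono[OF b[of J], of "periodization UNIV f x"] S
    by (simp add: r1_def r_def share_def)
  have r2: "\<bar>r2\<bar> \<le> k\<^sup>2 * r" using divide_right_mono[OF b2[of J], of "periodization UNIV f x"] S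
    by (simp add: r2_def r_def share_def)
  have s1: "\<bar>s1\<bar> \<le> k" using divide_right_mono[OF b[of UNIV], of "periodization UNIV f x"] S
    by (simp add: s1_def)
  have s2: "\<bar>s2\<bar> \<le> k\<^sup>2" using divide_right_mono[OF b2[of UNIV], of "periodization UNIV f x"] S
    by (simp add: s2_def)
  have "\<bar>r1 * s1\<bar> \<le> (k * r) * k" unfolding abs_mult using r1 s1 assms(3) r0 by (intro mult_mono) auto
  moreover have "\<bar>r * s2\<bar> \<le> r * k\<^sup>2" unfolding abs_mult using s2 r0 by (simp add: mult_left_mono)
  moreover have "\<bar>r * s1\<^sup>2\<bar> \<le> r * k\<^sup>2"
    unfolding abs_mult using s1 r0 assms(3) by (auto intro!: mult_left_mono simp: abs_le_square_iff[symmetric])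
  moreover have "\<bar>r2 - 2 * (r1 * s1) - r * s2 + 2 * (r * s1\<^sup>2)\<bar> \<le>
      \<bar>r2\<bar> + 2 * \<bar>r1 * s1\<bar> + \<bar>r * s2\<bar> + 2 * \<bar>r * s1\<^sup>2\<bar>" by linarith
  \<comment> \<open>The four terms contribute 1, 2, 1 and 2 times k^2 r, which explains the factor
    6.\<close>
  ultimately have "\<bar>r2 - 2 * (r1 * s1) - r * s2 + 2 * (r * s1\<^sup>2)\<bar> \<le> k\<^sup>2 * r + 2 * ((k * r) * k) + r * k\<^sup>2 + 2 * (r * k\<^sup>2)"
    using r2 by linarith
  then show ?thesis
    by (simp add: share''_def r_def[symmetric] r1_def[symmetric] r2_def[symmetric] s1_def[symmetric]
        s2_def[symmetric] power2_eq_square algebra_simps)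
qed

text \<open>The input of \<open>fourier_integral_decay\<close> with \<open>lattice\<close> as
  exceptional set. The singular and the regular case meet in this predicate.\<close>

definition twice_diff_decaying :: "(real \<Rightarrow> real) \<Rightarrow> bool" where
  "twice_diff_decaying U \<longleftrightarrow> (\<exists>D E K.
     (\<forall>x. \<bar>U x\<bar> \<le> K / (1 + x\<^sup>2) \<and> \<bar>D x\<bar> \<le> K / (1 + x\<^sup>2) \<and> \<bar>E x\<bar> \<le> K / (1 + x\<^sup>2)) \<and>
     continuous_on UNIV U \<and> continuous_on UNIV D \<and>
     (\<forall>x. x \<notin> lattice \<longrightarrow> (U has_real_derivative D x) (at x) \<and> (D has_real_derivative E x) (at x)))"

text \<open>The parameter \<open>m\<close> switches between the cases: m = 1 lets the first
  logarithmic derivative grow like 1/\<bar>x\<bar> at 0, m = 0 keeps it bounded. The second bound is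
  the square of the first, so that a single quantity governs both.\<close>

locale spectral_profile =
  fixes \<Phi> \<Phi>1 \<Phi>2 :: "real \<Rightarrow> real" and C m :: real
  assumes Phi_pos: "x \<noteq> 0 \<Longrightarrow> \<Phi> x > 0"
    and Phi_deriv: "x \<noteq> 0 \<Longrightarrow> (\<Phi> has_real_derivative \<Phi>1 x) (at x)"
    and Phi1_deriv: "x \<noteq> 0 \<Longrightarrow> (\<Phi>1 has_real_derivative \<Phi>2 x) (at x)"
    and C_pos: "C > 0" and m_nonneg: "m \<ge> 0"
    and Phi1_bound: "x \<noteq> 0 \<Longrightarrow> \<bar>\<Phi>1 x\<bar> \<le> C * (1 + m / \<bar>x\<bar>) * \<Phi> x"
    and Phi2_bound: "x \<noteq> 0 \<Longrightarrow> \<bar>\<Phi>2 x\<bar> \<le> (C * (1 + m / \<bar>x\<bar>))\<^sup>2 * \<Phi> x"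
    and Phi_decay: "\<delta> > 0 \<Longrightarrow> \<exists>B. \<forall>x. \<bar>x\<bar> \<ge> \<delta> \<longrightarrow> \<Phi> x \<le> B / (1 + x\<^sup>2)"
begin

abbreviation "S \<equiv> periodization UNIV \<Phi>"

text \<open>Nonincreasing in the distance: evaluated at \<open>lattice_dist x\<close> it bounds the
  logarithmic derivatives at all lattice translates of x at once.\<close>

definition kappa :: "real \<Rightarrow> real" where "kappa d = C * (1 + m / d)"

lemma kappa_nonneg: "d > 0 \<Longrightarrow> kappa d \<ge> 0"
  using C_pos m_nonneg by (simp add: kappa_def)

lemma Phi_bounds_kappa:
  assumes "d > 0" "d \<le> \<bar>x\<bar>"
  shows "\<bar>\<Phi>1 x\<bar> \<le> kappa d * \<Phi> x" "\<bar>\<Phi>2 x\<bar> \<le> (kappa d)\<^sup>2 * \<Phi> x"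
proof -
  have x: "x \<noteq> 0" using assms by auto
  have k: "C * (1 + m / \<bar>x\<bar>) \<le> kappa d" unfolding kappa_def
    using assms C_pos m_nonneg by (intro mult_left_mono add_left_mono divide_left_mono mult_pos_pos) auto
  have k0: "0 \<le> C * (1 + m / \<bar>x\<bar>)" using C_pos m_nonneg by simp
  show "\<bar>\<Phi>1 x\<bar> \<le> kappa d * \<Phi> x"
    using Phi1_bound[OF x] mult_right_mono[OF k, of "\<Phi> x"] Phi_pos[OF x] by linarith
  show "\<bar>\<Phi>2 x\<bar> \<le> (kappa d)\<^sup>2 * \<Phi> x"
    using Phi2_bound[OF x] mult_right_mono[OF power_mono[OF k k0, of 2], of "\<Phi> x"] Phi_pos[OF x] by linarith
qed

lemma decay_all:
  assumes "\<delta> > 0"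
  obtains B where "B \<ge> 0" "\<And>x. \<bar>x\<bar> \<ge> \<delta> \<Longrightarrow> \<bar>\<Phi> x\<bar> \<le> B / (1 + x\<^sup>2)"
    "\<And>x. \<bar>x\<bar> \<ge> \<delta> \<Longrightarrow> \<bar>\<Phi>1 x\<bar> \<le> B / (1 + x\<^sup>2)" "\<And>x. \<bar>x\<bar> \<ge> \<delta> \<Longrightarrow> \<bar>\<Phi>2 x\<bar> \<le> B / (1 + x\<^sup>2)"
proof -
  obtain A where A: "\<And>x. \<bar>x\<bar> \<ge> \<delta> \<Longrightarrow> \<Phi> x \<le> A / (1 + x\<^sup>2)" using Phi_decay[OF assms] by blast
  define q where "q = kappa \<delta>"
  have q: "q \<ge> 0" using kappa_nonneg[OF assms] by (simp add: q_def)
  define B where "B = (1 + q + q\<^sup>2) * \<bar>A\<bar>"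
  have *: "t * \<Phi> x \<le> B / (1 + x\<^sup>2)" if "\<bar>x\<bar> \<ge> \<delta>" "0 \<le> t" "t \<le> 1 + q + q\<^sup>2" for t x
  proof -
    have "\<Phi> x > 0" using that assms by (intro Phi_pos) auto
    moreover have "\<Phi> x \<le> \<bar>A\<bar> / (1 + x\<^sup>2)"
      by (rule order_trans[OF A[OF that(1)] divide_right_mono]) (auto intro: add_nonneg_nonneg)
    ultimately have "t * \<Phi> x \<le> (1 + q + q\<^sup>2) * (\<bar>A\<bar> / (1 + x\<^sup>2))"
      using that by (intro mult_mono) auto
    then show ?thesis by (simp add: B_def)
  qed
  show ?thesis
  proof (rule that[of B])
    show "B \<ge> 0" using q by (simp add: B_def)
    fix x assume x: "\<bar>x\<bar> \<ge> \<delta>"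
    have "\<Phi> x > 0" using x assms by (intro Phi_pos) auto
    then show "\<bar>\<Phi> x\<bar> \<le> B / (1 + x\<^sup>2)" using *[OF x, of 1] q by simp
    show "\<bar>\<Phi>1 x\<bar> \<le> B / (1 + x\<^sup>2)"
      using Phi_bounds_kappa(1)[OF assms x] *[OF x, of q] q by (simp add: q_def)
    show "\<bar>\<Phi>2 x\<bar> \<le> B / (1 + x\<^sup>2)"
      using Phi_bounds_kappa(2)[OF assms x] *[OF x, of "q\<^sup>2"] q by (simp add: q_def)
  qed
qed

lemma near_off_lattice:
  assumes "\<bar>y - x\<bar> < lattice_dist x / 2"
  shows "lattice_dist x / 2 \<le> \<bar>y + 2 * pi * of_int j\<bar>"
  using assms lattice_dist_le[of x j] by linarith

lemma open_off_lattice: "open (- lattice)"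
  unfolding open_dist
proof
  fix x assume x: "x \<in> - lattice"
  have "y \<in> - lattice" if "dist y x < lattice_dist x / 2" for y
  proof
    assume "y \<in> lattice"
    then obtain k :: int where "y = 2 * pi * of_int k" by (auto simp: lattice_def)
    then show False using near_off_lattice[of y x "- k"] that lattice_dist_pos[of x] x
      by (simp add: dist_real_def)
  qed
  then show "\<exists>e>0. \<forall>y. dist y x < e \<longrightarrow> y \<in> - lattice"
    using lattice_dist_pos[of x] x by (intro exI[of _ "lattice_dist x / 2"]) auto
qed

lemma off_lattice_integrable:
  assumes "x \<notin> lattice"
  shows "integrable (count_space J) (\<lambda>j. \<Phi> (x + 2 * pi * of_int j))"
    "integrable (count_space J) (\<lambda>j. \<Phi>1 (x + 2 * pi * of_int j))"
    "integrable (count_space J) (\<lambda>j. \<Phi>2 (x + 2 * pi * of_int j))"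
proof -
  obtain B where "\<And>y. \<bar>y\<bar> \<ge> lattice_dist x \<Longrightarrow> \<bar>\<Phi> y\<bar> \<le> B / (1 + y\<^sup>2)"
    "\<And>y. \<bar>y\<bar> \<ge> lattice_dist x \<Longrightarrow> \<bar>\<Phi>1 y\<bar> \<le> B / (1 + y\<^sup>2)"
    "\<And>y. \<bar>y\<bar> \<ge> lattice_dist x \<Longrightarrow> \<bar>\<Phi>2 y\<bar> \<le> B / (1 + y\<^sup>2)"
    by (rule decay_all[OF lattice_dist_pos[OF assms]]) blast
  then show "integrable (count_space J) (\<lambda>j. \<Phi> (x + 2 * pi * of_int j))"
    "integrable (count_space J) (\<lambda>j. \<Phi>1 (x + 2 * pi * of_int j))"
    "integrable (count_space J) (\<lambda>j. \<Phi>2 (x + 2 * pi * of_int j))"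
    using lattice_dist_le[of x] by (auto intro!: periodization_integrable)
qed

lemma periodization_derivs:
  assumes "x \<notin> lattice"
  shows "(periodization J \<Phi> has_real_derivative periodization J \<Phi>1 x) (at x)"
    "(periodization J \<Phi>1 has_real_derivative periodization J \<Phi>2 x) (at x)"
proof -
  define d where "d = lattice_dist x / 2"
  have d: "d > 0" using lattice_dist_pos[OF assms] by (simp add: d_def)
  have near: "d \<le> \<bar>y + 2 * pi * of_int j\<bar>" "y + 2 * pi * of_int j \<noteq> 0" if "\<bar>y - x\<bar> < d" for y j
    using near_off_lattice[of y x j] that d by (auto simp: d_def)
  obtain B where B: "B \<ge> 0" "\<And>y. \<bar>y\<bar> \<ge> d \<Longrightarrow> \<bar>\<Phi> y\<bar> \<le> B / (1 + y\<^sup>2)"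
    "\<And>y. \<bar>y\<bar> \<ge> d \<Longrightarrow> \<bar>\<Phi>1 y\<bar> \<le> B / (1 + y\<^sup>2)" "\<And>y. \<bar>y\<bar> \<ge> d \<Longrightarrow> \<bar>\<Phi>2 y\<bar> \<le> B / (1 + y\<^sup>2)"
    by (rule decay_all[OF d]) blast
  show "(periodization J \<Phi> has_real_derivative periodization J \<Phi>1 x) (at x)"
    by (rule periodization_has_derivative[OF d B(1)]) (use near B in \<open>auto intro!: Phi_deriv\<close>)
  show "(periodization J \<Phi>1 has_real_derivative periodization J \<Phi>2 x) (at x)"
    by (rule periodization_has_derivative[OF d B(1)]) (use near B in \<open>auto intro!: Phi1_deriv\<close>)
qed

lemma periodization_bounds:
  assumes "x \<notin> lattice"
  shows "\<bar>periodization J \<Phi>1 x\<bar> \<le> kappa (lattice_dist x) * periodization J \<Phi> x"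
    "\<bar>periodization J \<Phi>2 x\<bar> \<le> (kappa (lattice_dist x))\<^sup>2 * periodization J \<Phi> x"
  by (intro periodization_abs_le off_lattice_integrable assms Phi_bounds_kappa lattice_dist_le
      lattice_dist_pos)+

lemma off_lattice_nonneg: "x \<notin> lattice \<Longrightarrow> periodization J \<Phi> x \<ge> 0"
  by (intro periodization_nonneg less_imp_le[OF Phi_pos] shift_lattice)

lemma S_ge:
  assumes "x \<notin> lattice"
  shows "\<Phi> (x + 2 * pi * of_int j) \<le> S x"
  using periodization_split[OF off_lattice_integrable(1)[OF assms], of "{j}"]
    off_lattice_nonneg[OF assms, of "- {j}"] by (simp add: periodization_singleton)

lemma S_pos: "x \<notin> lattice \<Longrightarrow> S x > 0"
  using S_ge[of x 0] Phi_pos[OF shift_lattice[of x 0]] by simp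

lemma share_derivs:
  assumes "x \<notin> lattice"
  shows "(share \<Phi> J has_real_derivative share' \<Phi> \<Phi>1 J x) (at x)"
    "(share' \<Phi> \<Phi>1 J has_real_derivative share'' \<Phi> \<Phi>1 \<Phi>2 J x) (at x)"
proof -
  note S = S_pos[OF assms] and d = periodization_derivs[OF assms]
  show 1: "(share \<Phi> J has_real_derivative share' \<Phi> \<Phi>1 J x) (at x)"
    unfolding share_def[abs_def]
    by (rule DERIV_cong[OF DERIV_divide[OF d(1) d(1)]])
      (use S in \<open>auto simp: share'_def share_def field_simps\<close>)
  show "(share' \<Phi> \<Phi>1 J has_real_derivative share'' \<Phi> \<Phi>1 \<Phi>2 J x) (at x)"
    unfolding share'_def[abs_def]
    by (rule DERIV_cong[OF DERIV_diff[OF DERIV_divide[OF d(2) d(1)] DERIV_mult[OF 1 DERIV_divide[OF d(2) d(1)]]]])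
      (use S in \<open>auto simp: share''_def share'_def share_def field_simps power2_eq_square\<close>)
qed

lemma share_complement:
  assumes "x \<notin> lattice"
  shows "share \<Phi> J x = 1 - share \<Phi> (- J) x" "share' \<Phi> \<Phi>1 J x = - share' \<Phi> \<Phi>1 (- J) x"
    "share'' \<Phi> \<Phi>1 \<Phi>2 J x = - share'' \<Phi> \<Phi>1 \<Phi>2 (- J) x"
proof -
  note s = off_lattice_integrable[OF assms, of UNIV, THEN periodization_split[of _ x J]]
  define a b a1 b1 a2 b2 where ab: "a = periodization J \<Phi> x" "b = periodization (- J) \<Phi> x"
    "a1 = periodization J \<Phi>1 x" "b1 = periodization (- J) \<Phi>1 x"
    "a2 = periodization J \<Phi>2 x" "b2 = periodization (- J) \<Phi>2 x"
  have "a + b \<noteq> 0" using S_pos[OF assms] s(1) by (simp add: ab)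
  then show "share \<Phi> J x = 1 - share \<Phi> (- J) x" "share' \<Phi> \<Phi>1 J x = - share' \<Phi> \<Phi>1 (- J) x"
    "share'' \<Phi> \<Phi>1 \<Phi>2 J x = - share'' \<Phi> \<Phi>1 \<Phi>2 (- J) x"
    unfolding share_def share'_def share''_def s ab[symmetric]
    by (simp_all add: divide_simps) (simp_all add: power2_eq_square algebra_simps)
qed

lemma share_bounds:
  assumes "x \<notin> lattice"
  shows "\<bar>share' \<Phi> \<Phi>1 J x\<bar> \<le> 2 * kappa (lattice_dist x) * share \<Phi> J x"
    "\<bar>share'' \<Phi> \<Phi>1 \<Phi>2 J x\<bar> \<le> 6 * (kappa (lattice_dist x))\<^sup>2 * share \<Phi> J x"
  using assms by (intro share'_bound share''_bound S_pos off_lattice_nonneg periodization_bounds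
      kappa_nonneg lattice_dist_pos; simp)+

lemma has_derivative_extend_lattice:
  assumes "x \<notin> lattice" "(f has_real_derivative f') (at x)" "\<And>y. y \<notin> lattice \<Longrightarrow> g y = f y"
  shows "(g has_real_derivative f') (at x)"
  using has_field_derivative_transform_within_open[OF assms(2) open_off_lattice] assms(1,3) by auto

end

section \<open>Behaviour of the quotient at lattice points\<close>

lemma nearest_index_unique:
  assumes "\<bar>y - 2 * pi * of_int k\<bar> < pi"
  shows "nearest_index y = k"
proof (rule ccontr)
  assume "nearest_index y \<noteq> k"
  then have "pi \<le> \<bar>(y - 2 * pi * of_int k) + 2 * pi * of_int (k - nearest_index y)\<bar>"
    using assms by (intro pi_le_shift) auto
  then have "pi \<le> lattice_dist y" by (simp add: lattice_dist_def algebra_simps)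
  moreover have "lattice_dist y \<le> \<bar>y - 2 * pi * of_int k\<bar>" using lattice_dist_le[of y "- k"] by simp
  ultimately show False using assms by simp
qed

lemma near_lattice_point:
  assumes "\<bar>y - 2 * pi * of_int k\<bar> < pi" "y \<noteq> 2 * pi * of_int k"
  shows "y \<notin> lattice"
proof
  assume "y \<in> lattice"
  then obtain l :: int where l: "y = 2 * pi * of_int l" by (auto simp: lattice_def)
  with assms have "pi \<le> \<bar>0 + 2 * pi * of_int (l - k)\<bar>" by (intro pi_le_shift) auto
  then show False using assms(1) by (simp add: l algebra_simps)
qed

text \<open>Verifies that a value assigned by hand at a lattice point is the limit from outside.
  Points closer than pi to it are off the lattice and have it as nearest lattice point.\<close>

lemma isCont_of_bound_near_lattice_point:
  fixes f :: "real \<Rightarrow> real"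
  assumes "\<And>y. y \<notin> lattice \<Longrightarrow> nearest_index y = k \<Longrightarrow> \<bar>f y - f (2 * pi * of_int k)\<bar> \<le> K * lattice_dist y"
    and "K \<ge> 0"
  shows "isCont f (2 * pi * of_int k)"
proof -
  let ?x = "2 * pi * real_of_int k"
  have "\<forall>\<^sub>F y in at ?x. \<bar>y - ?x\<bar> < pi \<and> y \<noteq> ?x"
    by (auto simp: eventually_at dist_real_def intro!: exI[of _ pi])
  then have "\<forall>\<^sub>F y in at ?x. norm (f y - f ?x) \<le> K * \<bar>y - ?x\<bar>"
  proof eventually_elim
    case (elim y)
    have "\<bar>f y - f ?x\<bar> \<le> K * lattice_dist y"
      using near_lattice_point[of y k] nearest_index_unique[of y k] elim by (intro assms(1)) auto
    also have "\<dots> \<le> K * \<bar>y - ?x\<bar>"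
      using lattice_dist_le[of y "- k"] assms(2) by (intro mult_left_mono) auto
    finally show ?case by simp
  qed
  moreover have "((\<lambda>y. K * \<bar>y - ?x\<bar>) \<longlongrightarrow> 0) (at ?x)"
    by (rule tendsto_eq_intros refl | simp)+
  ultimately have "((\<lambda>y. f y - f ?x) \<longlongrightarrow> 0) (at ?x)"
    by (rule Lim_null_comparison)
  then show ?thesis unfolding isCont_def by (rule LIM_zero_cancel)
qed

context spectral_profile
begin

text \<open>Near a lattice point either \<open>u\<close> or \<open>1 - u\<close> vanishes to second order, where \<open>u\<close> is the
  quotient; since both have, up to sign, the same derivatives, this compensates the singularity
  of the logarithmic derivatives of \<open>\<Phi>\<close>.\<close>

lemma share_small_near_lattice:
  assumes sing: "c0 > 0" "\<And>x. x \<noteq> 0 \<Longrightarrow> \<bar>x\<bar> \<le> pi \<Longrightarrow> c0 / x\<^sup>2 \<le> \<Phi> x"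
  obtains K where "K \<ge> 0"
    "\<And>x. x \<notin> lattice \<Longrightarrow> share \<Phi> (if nearest_index x = 0 then - {0} else {0}) x \<le> K * (lattice_dist x)\<^sup>2 / (1 + x\<^sup>2)"
proof -
  obtain B where B: "B \<ge> 0" "\<And>x. \<bar>x\<bar> \<ge> pi \<Longrightarrow> \<bar>\<Phi> x\<bar> \<le> B / (1 + x\<^sup>2)"
    by (rule decay_all[OF pi_gt_zero]) blast
  \<comment> \<open>For \<bar>x\<bar> \<le> pi all terms with nonzero index are evaluated at
    distance at least pi from 0, where \<open>B\<close> applies; \<open>P\<close> bounds their
    sum.\<close>
  define P where "P = B * (2 * (1 + pi\<^sup>2) * (LINT j|count_space (- {0::int}). 1 / (1 + (real_of_int j)\<^sup>2)))"
  define K where "K = B / c0 + P * (1 + pi\<^sup>2) / c0"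
  have P0: "P \<ge> 0" unfolding P_def using B(1)
    by (intro mult_nonneg_nonneg Bochner_Integration.integral_nonneg) auto
  have K0: "K \<ge> 0" using P0 B(1) sing(1) by (simp add: K_def)
  \<comment> \<open>The single term at the nearest lattice point already makes the denominator this
    large.\<close>
  have S: "c0 / (lattice_dist x)\<^sup>2 \<le> S x" if "x \<notin> lattice" for x
  proof -
    have "c0 / (x + 2 * pi * of_int (- nearest_index x))\<^sup>2 \<le> \<Phi> (x + 2 * pi * of_int (- nearest_index x))"
      using shift_lattice[OF that, of "- nearest_index x"] lattice_dist_le_pi[of x] by (intro sing(2)) (auto simp: lattice_dist_def)
    also have "\<dots> \<le> S x" by (rule S_ge[OF that])
    finally show ?thesis by (simp add: lattice_dist_def)
  qed
  have small: "share \<Phi> J x \<le> A * (lattice_dist x)\<^sup>2 / c0" if "x \<notin> lattice" "periodization J \<Phi> x \<le> A" for J x A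
  proof -
    have "0 \<le> A" using that(2) off_lattice_nonneg[OF that(1), of J] by linarith
    then have "share \<Phi> J x \<le> A / (c0 / (lattice_dist x)\<^sup>2)"
      unfolding share_def using that S[OF that(1)] sing(1) lattice_dist_pos[OF that(1)]
      by (intro frac_le) auto
    then show ?thesis by simp
  qed
  have "share \<Phi> (if nearest_index x = 0 then - {0} else {0}) x \<le> K * (lattice_dist x)\<^sup>2 / (1 + x\<^sup>2)"
    if x: "x \<notin> lattice" for x
  proof (cases "nearest_index x = 0")
    case True
    then have xp: "\<bar>x\<bar> \<le> pi" using lattice_dist_le_pi[of x] by (simp add: lattice_dist_def)
    then have x2: "x\<^sup>2 \<le> pi\<^sup>2" by (simp add: abs_le_square_iff[symmetric])
    have "periodization (- {0}) \<Phi> x \<le> (LINT j|count_space (- {0::int}). B * (2 * (1 + pi\<^sup>2) * (1 / (1 + (of_int j)\<^sup>2))))"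
      unfolding periodization_def
    proof (rule integral_mono)
      fix j assume "j \<in> space (count_space (- {0::int}))"
      then have "\<bar>\<Phi> (x + 2 * pi * of_int j)\<bar> \<le> B / (1 + (x + 2 * pi * of_int j)\<^sup>2)"
        using xp by (intro B(2) pi_le_shift) auto
      then have "\<Phi> (x + 2 * pi * of_int j) \<le> B * (1 / (1 + (x + 2 * pi * of_int j)\<^sup>2))" by simp
      also have "\<dots> \<le> B * (2 * (1 + x\<^sup>2) * (1 / (1 + (of_int j)\<^sup>2)))"
        by (intro mult_left_mono one_div_one_plus_square_shift_2pi B)
      also have "\<dots> \<le> B * (2 * (1 + pi\<^sup>2) * (1 / (1 + (of_int j)\<^sup>2)))"
        using B(1) x2 by (intro mult_left_mono mult_right_mono) auto
      finally show "\<Phi> (x + 2 * pi * of_int j) \<le> B * (2 * (1 + pi\<^sup>2) * (1 / (1 + (of_int j)\<^sup>2)))" .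
    qed (intro off_lattice_integrable x integrable_mult_right integrable_count_space_int_one_div_one_plus_square)+
    also have "\<dots> = P" unfolding P_def by (simp only: integral_mult_right_zero)
    finally have "share \<Phi> (- {0}) x \<le> P * (lattice_dist x)\<^sup>2 / c0" by (rule small[OF x])
    \<comment> \<open>The decay factor is inserted for free up to a constant, as \<bar>x\<bar> \<le>
      pi here.\<close>
    also have "\<dots> \<le> P * (lattice_dist x)\<^sup>2 / c0 * ((1 + pi\<^sup>2) / (1 + x\<^sup>2))"
    proof -
      have "1 \<le> (1 + pi\<^sup>2) / (1 + x\<^sup>2)" using x2 by (simp add: pos_le_divide_eq add_pos_nonneg)
      then show ?thesis using mult_left_mono[of 1 "(1 + pi\<^sup>2) / (1 + x\<^sup>2)" "P * (lattice_dist x)\<^sup>2 / c0"] P0 sing(1) by simp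
    qed
    also have "\<dots> = (P * (1 + pi\<^sup>2) / c0) * ((lattice_dist x)\<^sup>2 / (1 + x\<^sup>2))" by simp
    also have "\<dots> \<le> K * ((lattice_dist x)\<^sup>2 / (1 + x\<^sup>2))"
      using B(1) sing(1) by (intro mult_right_mono) (auto simp: K_def)
    finally show ?thesis using True by simp
  next
    case False
    \<comment> \<open>Here x is at least pi away from 0, so the numerator decays while the
      denominator is large near its lattice point.\<close>
    then have "pi \<le> \<bar>(x - 2 * pi * of_int (nearest_index x)) + 2 * pi * of_int (nearest_index x)\<bar>"
      using lattice_dist_le_pi[of x] by (intro pi_le_shift) (auto simp: lattice_dist_def)
    then have "\<bar>\<Phi> x\<bar> \<le> B / (1 + x\<^sup>2)" by (intro B(2)) simp
    then have "share \<Phi> {0} x \<le> B / (1 + x\<^sup>2) * (lattice_dist x)\<^sup>2 / c0"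
      by (intro small x) (simp add: periodization_singleton)
    also have "\<dots> = (B / c0) * ((lattice_dist x)\<^sup>2 / (1 + x\<^sup>2))" by simp
    also have "\<dots> \<le> K * ((lattice_dist x)\<^sup>2 / (1 + x\<^sup>2))"
      using P0 sing(1) by (intro mult_right_mono) (auto simp: K_def)
    finally show ?thesis using False by simp
  qed
  then show ?thesis by (rule that[OF K0])
qed

lemma share_le_1: "x \<notin> lattice \<Longrightarrow> share \<Phi> J x \<le> 1"
  using share_complement(1)[of x J] off_lattice_nonneg[of x "- J"] S_pos[of x] by (simp add: share_def[of _ "- J"])

lemma share_nonneg: "x \<notin> lattice \<Longrightarrow> share \<Phi> J x \<ge> 0"
  using off_lattice_nonneg[of x J] S_pos[of x] by (simp add: share_def)

text \<open>The pole forces the limit 1 at 0 and 0 at the other lattice points. Of the two factors d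
  in the smallness bound, the first derivative consumes one and still tends to 0 on the lattice; the
  second derivative consumes both and stays bounded.\<close>

lemma twice_diff_decaying_singular:
  assumes sing: "c0 > 0" "\<And>x. x \<noteq> 0 \<Longrightarrow> \<bar>x\<bar> \<le> pi \<Longrightarrow> c0 / x\<^sup>2 \<le> \<Phi> x"
  shows "twice_diff_decaying (\<lambda>x. if x \<in> lattice then of_bool (x = 0) else share \<Phi> {0} x)"
    (is "twice_diff_decaying ?U")
proof -
  obtain K where K: "K \<ge> 0" "\<And>x. x \<notin> lattice \<Longrightarrow>
      share \<Phi> (if nearest_index x = 0 then - {0} else {0}) x \<le> K * (lattice_dist x)\<^sup>2 / (1 + x\<^sup>2)"
    using share_small_near_lattice[OF sing] by blast
  define D where "D x = (if x \<in> lattice then 0 else share' \<Phi> \<Phi>1 {0} x)" for x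
  define E where "E x = (if x \<in> lattice then 0 else share'' \<Phi> \<Phi>1 \<Phi>2 {0} x)" for x
  \<comment> \<open>The product of \<open>kappa d\<close> and d equals C (d + m), and d is at most
    pi.\<close>
  define q where "q = C * (pi + m)"
  have q0: "q \<ge> 0" using C_pos m_nonneg by (simp add: q_def)
  have kap: "kappa (lattice_dist x) * lattice_dist x \<le> q" "0 \<le> kappa (lattice_dist x) * lattice_dist x"
    if "x \<notin> lattice" for x
  proof -
    note d = lattice_dist_pos[OF that]
    have "kappa (lattice_dist x) * lattice_dist x = C * (lattice_dist x + m)"
      using d by (simp add: kappa_def field_simps)
    then show "kappa (lattice_dist x) * lattice_dist x \<le> q"
      using lattice_dist_le_pi[of x] C_pos by (simp add: q_def)
    show "0 \<le> kappa (lattice_dist x) * lattice_dist x" using d kappa_nonneg[OF d] by simp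
  qed
  have D: "\<bar>D x\<bar> \<le> 2 * q * K * lattice_dist x / (1 + x\<^sup>2)" and E: "\<bar>E x\<bar> \<le> 6 * q\<^sup>2 * K / (1 + x\<^sup>2)"
    if x: "x \<notin> lattice" for x
  proof -
    define J :: "int set" where "J = (if nearest_index x = 0 then - {0} else {0})"
    define d where "d = lattice_dist x"
    define k where "k = kappa d"
    note kap = kap[OF x, folded d_def, folded k_def]
    have d: "d > 0" "k \<ge> 0" using lattice_dist_pos[OF x] kappa_nonneg by (auto simp: d_def k_def)
    have J: "J = {0} \<or> J = - {0}" by (auto simp: J_def)
    have sm: "share \<Phi> J x \<le> K * d\<^sup>2 / (1 + x\<^sup>2)" using K(2)[OF x] by (simp add: J_def d_def)
    have "\<bar>D x\<bar> = \<bar>share' \<Phi> \<Phi>1 J x\<bar>" "\<bar>E x\<bar> = \<bar>share'' \<Phi> \<Phi>1 \<Phi>2 J x\<bar>"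
      using J share_complement(2,3)[OF x, of "{0}"] x by (auto simp: D_def E_def)
    then have le: "\<bar>D x\<bar> \<le> 2 * k * share \<Phi> J x" "\<bar>E x\<bar> \<le> 6 * k\<^sup>2 * share \<Phi> J x"
      using share_bounds[OF x, of J] by (auto simp: k_def d_def)
    have "2 * k * share \<Phi> J x \<le> 2 * k * (K * d\<^sup>2 / (1 + x\<^sup>2))" using sm d by (intro mult_left_mono) auto
    also have "\<dots> = 2 * (K * d / (1 + x\<^sup>2)) * (k * d)" by (simp add: power2_eq_square)
    also have "\<dots> \<le> 2 * (K * d / (1 + x\<^sup>2)) * q" using kap K(1) d by (intro mult_left_mono) auto
    finally show "\<bar>D x\<bar> \<le> 2 * q * K * lattice_dist x / (1 + x\<^sup>2)" using le(1) by (simp add: d_def mult_ac)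
    have "6 * k\<^sup>2 * share \<Phi> J x \<le> 6 * k\<^sup>2 * (K * d\<^sup>2 / (1 + x\<^sup>2))" using sm d by (intro mult_left_mono) auto
    also have "\<dots> = 6 * (K / (1 + x\<^sup>2)) * (k * d)\<^sup>2" by (simp add: power2_eq_square)
    also have "\<dots> \<le> 6 * (K / (1 + x\<^sup>2)) * q\<^sup>2" using kap K(1) by (intro mult_left_mono power_mono) auto
    finally show "\<bar>E x\<bar> \<le> 6 * q\<^sup>2 * K / (1 + x\<^sup>2)" using le(2) by (simp add: mult_ac)
  qed
  have U: "\<bar>?U y - of_bool (nearest_index y = 0)\<bar> \<le> K * (lattice_dist y)\<^sup>2 / (1 + y\<^sup>2)" if y: "y \<notin> lattice" for y
  proof (cases "nearest_index y = 0")
    case True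
    then show ?thesis
      using K(2)[OF y] share_complement(1)[OF y, of "{0}"] share_nonneg[OF y, of "- {0}"] y by simp
  next
    case False
    then show ?thesis using K(2)[OF y] share_nonneg[OF y, of "{0}"] y by simp
  qed
  \<comment> \<open>The sum dominates every constant that occurs. The summand 1 + pi^2 is for points
    whose nearest lattice point is 0, where only u \<le> 1 is available.\<close>
  define T where "T = (1 + pi\<^sup>2) + K * pi\<^sup>2 + 2 * q * K * pi + 6 * q\<^sup>2 * K"
  have T: "1 + pi\<^sup>2 \<le> T" "K * pi\<^sup>2 \<le> T" "2 * q * K * pi \<le> T" "6 * q\<^sup>2 * K \<le> T" "0 \<le> T"
    using K(1) q0 by (auto simp: T_def intro!: add_nonneg_nonneg add_increasing add_increasing2)
  have bU: "\<bar>?U x\<bar> \<le> T / (1 + x\<^sup>2)" for x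
  proof (cases "x \<in> lattice")
    case True
    have "(1::real) \<le> T" using T(1) zero_le_power2[of pi] by linarith
    then show ?thesis using True T by auto
  next
    case False
    note d2 = power_mono[OF lattice_dist_le_pi[of x], of 2]
    show ?thesis
    proof (cases "nearest_index x = 0")
      case True
      then have "\<bar>x\<bar> \<le> pi" using lattice_dist_le_pi[of x] by (simp add: lattice_dist_def)
      then have "1 + x\<^sup>2 \<le> T" using T(1) abs_le_square_iff[of x pi] by simp
      then have "1 \<le> T / (1 + x\<^sup>2)" by (simp add: pos_le_divide_eq add_pos_nonneg)
      then show ?thesis using False share_le_1[OF False, of "{0}"] share_nonneg[OF False, of "{0}"] by simp
    next
      case n: False
      have "\<bar>?U x\<bar> \<le> K * (lattice_dist x)\<^sup>2 / (1 + x\<^sup>2)" using U[OF False] n by simp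
      also have "\<dots> \<le> K * pi\<^sup>2 / (1 + x\<^sup>2)"
        using d2 K(1) by (intro divide_right_mono mult_left_mono) (auto simp: lattice_dist_def)
      also have "\<dots> \<le> T / (1 + x\<^sup>2)" using T by (intro divide_right_mono) auto
      finally show ?thesis .
    qed
  qed
  have bD: "\<bar>D x\<bar> \<le> T / (1 + x\<^sup>2)" for x
  proof (cases "x \<in> lattice")
    case False
    have "\<bar>D x\<bar> \<le> 2 * q * K * lattice_dist x / (1 + x\<^sup>2)" by (rule D[OF False])
    also have "\<dots> \<le> 2 * q * K * pi / (1 + x\<^sup>2)"
      using lattice_dist_le_pi K(1) q0 by (intro divide_right_mono mult_left_mono) auto
    also have "\<dots> \<le> T / (1 + x\<^sup>2)" using T by (intro divide_right_mono) auto
    finally show ?thesis .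
  qed (use T in \<open>auto simp: D_def\<close>)
  have bE: "\<bar>E x\<bar> \<le> T / (1 + x\<^sup>2)" for x
  proof (cases "x \<in> lattice")
    case False
    then show ?thesis using E[OF False] T by (intro order_trans[OF E[OF False] divide_right_mono]) auto
  qed (use T in \<open>auto simp: E_def\<close>)
  have ders: "(?U has_real_derivative D x) (at x)" "(D has_real_derivative E x) (at x)" if "x \<notin> lattice" for x
  proof -
    have eq: "D x = share' \<Phi> \<Phi>1 {0} x" "E x = share'' \<Phi> \<Phi>1 \<Phi>2 {0} x" using that by (auto simp: D_def E_def)
    show "(?U has_real_derivative D x) (at x)" unfolding eq(1)
      by (rule has_derivative_extend_lattice[OF that share_derivs(1)[OF that]]) simp
    show "(D has_real_derivative E x) (at x)" unfolding eq(2)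
      by (rule has_derivative_extend_lattice[OF that share_derivs(2)[OF that]]) (simp add: D_def)
  qed
  have le1: "A / (1 + y\<^sup>2) \<le> A" if "A \<ge> 0" for A y :: real
    using that by (simp add: divide_le_eq add_pos_nonneg algebra_simps)
  have "isCont ?U x" for x
  proof (cases "x \<in> lattice")
    case True
    then obtain k where k: "x = 2 * pi * of_int k" by (auto simp: lattice_def)
    show ?thesis unfolding k
    proof (rule isCont_of_bound_near_lattice_point[where K = "K * pi"])
      fix y assume y: "y \<notin> lattice" "nearest_index y = k"
      have "\<bar>?U y - ?U (2 * pi * of_int k)\<bar> \<le> K * (lattice_dist y)\<^sup>2 / (1 + y\<^sup>2)"
        using U[OF y(1)] y(2) True by (simp add: k)
      also have "\<dots> \<le> K * (lattice_dist y)\<^sup>2" using K(1) by (intro le1) auto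
      also have "\<dots> \<le> K * pi * lattice_dist y"
        using K(1) lattice_dist_le_pi[of y] lattice_dist_pos[OF y(1)]
        by (auto simp: power2_eq_square mult.assoc intro!: mult_left_mono mult_right_mono)
      finally show "\<bar>?U y - ?U (2 * pi * of_int k)\<bar> \<le> K * pi * lattice_dist y" .
    qed (use K in auto)
  next
    case False
    show ?thesis by (rule DERIV_isCont[OF ders(1)[OF False]])
  qed
  moreover have "isCont D x" for x
  proof (cases "x \<in> lattice")
    case True
    then obtain k where k: "x = 2 * pi * of_int k" by (auto simp: lattice_def)
    show ?thesis unfolding k
    proof (rule isCont_of_bound_near_lattice_point[where K = "2 * q * K"])
      fix y assume y: "y \<notin> lattice" "nearest_index y = k"
      have "\<bar>D y - D (2 * pi * of_int k)\<bar> \<le> 2 * q * K * lattice_dist y / (1 + y\<^sup>2)"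
        using D[OF y(1)] True by (simp add: k D_def[of "2 * pi * of_int k"])
      also have "\<dots> \<le> 2 * q * K * lattice_dist y"
        using K(1) q0 lattice_dist_pos[OF y(1)] by (intro le1) auto
      finally show "\<bar>D y - D (2 * pi * of_int k)\<bar> \<le> 2 * q * K * lattice_dist y" .
    qed (use K q0 in auto)
  next
    case False
    show ?thesis by (rule DERIV_isCont[OF ders(2)[OF False]])
  qed
  ultimately show ?thesis
    unfolding twice_diff_decaying_def using bU bD bE ders
    by (intro exI[of _ D] exI[of _ E] exI[of _ T]) (auto simp: continuous_on_eq_continuous_at)
qed

text \<open>For m = 0 the bound \<open>kappa\<close> is the constant C. Some translate of x lies in
  [-pi, pi], so the denominator is at least \<open>c0\<close> everywhere, including the lattice, and
  all decay comes from the numerator. Only the second derivative has to be cut out at lattice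
  points.\<close>

lemma twice_diff_decaying_regular:
  assumes m: "m = 0" and pos0: "\<Phi> 0 > 0" and d0: "(\<Phi> has_real_derivative 0) (at 0)"
    and \<Phi>1: "\<Phi>1 0 = 0" "isCont \<Phi>1 0"
    and decay: "\<And>x. \<Phi> x \<le> B / (1 + x\<^sup>2)"
    and c0: "c0 > 0" "\<And>x. \<bar>x\<bar> \<le> pi \<Longrightarrow> c0 \<le> \<Phi> x"
  shows "twice_diff_decaying (share \<Phi> {0})"
proof -
  have pos: "\<Phi> x > 0" for x using pos0 Phi_pos[of x] by (cases "x = 0") auto
  have kC: "kappa d = C" for d unfolding kappa_def using m by simp
  have B0: "B \<ge> 0" using decay[of 0] pos0 by simp
  have b1: "\<bar>\<Phi>1 x\<bar> \<le> C * \<Phi> x" for x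
    using Phi1_bound[of x] m \<Phi>1(1) C_pos pos0 by (cases "x = 0") auto
  have d1: "(\<Phi> has_real_derivative \<Phi>1 x) (at x)" for x
    using Phi_deriv[of x] d0 \<Phi>1(1) by (cases "x = 0") auto
  have c1: "isCont \<Phi>1 x" for x
    using DERIV_isCont[OF Phi1_deriv[of x]] \<Phi>1(2) by (cases "x = 0") auto
  have dec: "\<bar>\<Phi> x\<bar> \<le> (1 + C) * B / (1 + x\<^sup>2)" "\<bar>\<Phi>1 x\<bar> \<le> (1 + C) * B / (1 + x\<^sup>2)" for x
  proof -
    have "C * \<Phi> x \<le> C * (B / (1 + x\<^sup>2))" using decay C_pos by (intro mult_left_mono) auto
    moreover have "0 \<le> C * (B / (1 + x\<^sup>2))" "0 \<le> B / (1 + x\<^sup>2)" using B0 C_pos by simp_all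
    moreover have "(1 + C) * B / (1 + x\<^sup>2) = B / (1 + x\<^sup>2) + C * (B / (1 + x\<^sup>2))"
      by (simp add: distrib_right add_divide_distrib)
    ultimately show "\<bar>\<Phi> x\<bar> \<le> (1 + C) * B / (1 + x\<^sup>2)" "\<bar>\<Phi>1 x\<bar> \<le> (1 + C) * B / (1 + x\<^sup>2)"
      using decay[of x] pos[of x] b1[of x] by linarith+
  qed
  have CB: "(1 + C) * B \<ge> 0" using C_pos B0 by simp
  have int: "integrable (count_space J) (\<lambda>j. \<Phi> (x + 2 * pi * of_int j))"
    "integrable (count_space J) (\<lambda>j. \<Phi>1 (x + 2 * pi * of_int j))" for J x
    by (rule periodization_integrable, rule dec)+
  have nonneg: "periodization J \<Phi> x \<ge> 0" for J x
    by (intro periodization_nonneg less_imp_le[OF pos])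
  have S_c0: "c0 \<le> S x" for x
  proof -
    have "c0 \<le> \<Phi> (x + 2 * pi * of_int (- nearest_index x))"
      using lattice_dist_le_pi[of x] by (intro c0(2)) (auto simp: lattice_dist_def)
    also have "\<dots> \<le> S x"
      using periodization_split[OF int(1), of x "{- nearest_index x}"] nonneg[of "- {- nearest_index x}" x]
      by (simp add: periodization_singleton)
    finally show ?thesis .
  qed
  have S: "S x > 0" for x using S_c0[of x] c0(1) by linarith
  have cS: "isCont (periodization J \<Phi>) x" "isCont (periodization J \<Phi>1) x" for J x
    using periodization_isCont[OF CB _ dec(1)] periodization_isCont[OF CB c1 dec(2)] DERIV_isCont[OF d1] by auto
  have u: "\<bar>share \<Phi> {0} x\<bar> \<le> B / c0 / (1 + x\<^sup>2)" for x
  proof -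
    have "share \<Phi> {0} x \<le> (B / (1 + x\<^sup>2)) / c0"
      unfolding share_def using decay[of x] S_c0[of x] c0(1) B0
      by (intro frac_le) (auto simp: periodization_singleton)
    moreover have "share \<Phi> {0} x \<ge> 0" using nonneg S[of x] by (simp add: share_def)
    ultimately show ?thesis by (simp add: mult.commute)
  qed
  \<comment> \<open>Covers the multiples 1, 2 C and 6 C^2 of the quotient that bound it and its two
    derivatives.\<close>
  define T where "T = (1 + 2 * C + 6 * C\<^sup>2) * (B / c0)"
  have scale: "t * share \<Phi> {0} x \<le> T / (1 + x\<^sup>2)" if "0 \<le> t" "t \<le> 1 + 2 * C + 6 * C\<^sup>2" for t x
  proof -
    have "t * share \<Phi> {0} x \<le> (1 + 2 * C + 6 * C\<^sup>2) * (B / c0 / (1 + x\<^sup>2))"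
      using that u[of x] nonneg S[of x] by (intro mult_mono) (auto simp: share_def abs_le_iff)
    then show ?thesis by (simp add: T_def)
  qed
  define E where "E x = (if x \<in> lattice then 0 else share'' \<Phi> \<Phi>1 \<Phi>2 {0} x)" for x
  have bU: "\<bar>share \<Phi> {0} x\<bar> \<le> T / (1 + x\<^sup>2)" for x
    using scale[of 1 x] C_pos nonneg S[of x] by (simp add: share_def)
  have bD: "\<bar>share' \<Phi> \<Phi>1 {0} x\<bar> \<le> T / (1 + x\<^sup>2)" for x
  proof -
    have "\<bar>share' \<Phi> \<Phi>1 {0} x\<bar> \<le> 2 * C * share \<Phi> {0} x"
      by (intro share'_bound S nonneg periodization_abs_le b1 int)
    also have "\<dots> \<le> T / (1 + x\<^sup>2)" using C_pos by (intro scale) auto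
    finally show ?thesis .
  qed
  have bE: "\<bar>E x\<bar> \<le> T / (1 + x\<^sup>2)" for x
  proof (cases "x \<in> lattice")
    case False
    then have "\<bar>E x\<bar> \<le> 6 * C\<^sup>2 * share \<Phi> {0} x" using share_bounds(2)[OF False, of "{0}"] by (simp add: E_def kC)
    also have "\<dots> \<le> T / (1 + x\<^sup>2)" using C_pos by (intro scale) auto
    finally show ?thesis .
  next
    case True
    then show ?thesis using scale[of 0 x] C_pos by (simp add: E_def)
  qed
  have nz: "S x \<noteq> 0" for x using S[of x] by simp
  have contU: "continuous_on UNIV (share \<Phi> {0})"
    unfolding share_def[abs_def] using nz cS by (intro continuous_at_imp_continuous_on ballI isCont_divide) auto
  have contD: "continuous_on UNIV (share' \<Phi> \<Phi>1 {0})"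
    unfolding share'_def[abs_def] share_def using nz cS
    by (intro continuous_at_imp_continuous_on ballI isCont_divide isCont_diff isCont_mult) auto
  show ?thesis
    unfolding twice_diff_decaying_def using bU bD bE contU contD share_derivs
    by (intro exI[of _ "share' \<Phi> \<Phi>1 {0}"] exI[of _ E] exI[of _ T]) (auto simp: E_def)
qed

end

subsection \<open>Decay of the fundamental function\<close>

text \<open>The recurrence at order a - 1 expresses x^2 times the moment by lower moments, which do
  not increase with \<bar>x\<bar>. The choice \<delta> = 0, admissible for a < 0, gives the global
  bound of the regular case.\<close>

lemma bessel_mix_decay:
  assumes "b > 0" "\<delta> \<noteq> 0 \<or> a < 0" "\<bar>\<delta>\<bar> \<le> \<bar>x\<bar>"
  shows "bessel_mix a b x \<le>
    (bessel_mix a b \<delta> + \<bar>a - 1\<bar> * bessel_mix (a - 1) b \<delta> + b * bessel_mix (a - 2) b \<delta>) / (1 + x\<^sup>2)"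
proof -
  have x: "x \<noteq> 0 \<or> a < 0" using assms by auto
  have "x\<^sup>2 * bessel_mix a b x = (a - 1) * bessel_mix (a - 1) b x + b * bessel_mix (a - 2) b x"
    using bessel_mix_recurrence[of b x "a - 1"] x assms(1) by simp
  also have "(a - 1) * bessel_mix (a - 1) b x \<le> \<bar>a - 1\<bar> * bessel_mix (a - 1) b \<delta>"
  proof (intro mult_mono)
    show "bessel_mix (a - 1) b x \<le> bessel_mix (a - 1) b \<delta>" using assms by (intro bessel_mix_antimono) auto
    show "0 \<le> bessel_mix (a - 1) b x" using assms(1) x by (intro less_imp_le bessel_mix_pos) auto
  qed auto
  also have "bessel_mix (a - 2) b x \<le> bessel_mix (a - 2) b \<delta>"
    using assms by (intro bessel_mix_antimono) auto
  finally have "x\<^sup>2 * bessel_mix a b x \<le> \<bar>a - 1\<bar> * bessel_mix (a - 1) b \<delta> + b * bessel_mix (a - 2) b \<delta>"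
    using assms(1) by simp
  moreover have "bessel_mix a b x \<le> bessel_mix a b \<delta>" using assms by (intro bessel_mix_antimono) auto
  ultimately show ?thesis by (simp add: pos_le_divide_eq add_pos_nonneg algebra_simps)
qed

text \<open>The ratio estimate divided by \<bar>x\<bar> once and twice, in the shape of
  \<open>spectral_profile\<close> with m = 1. The regular case uses it only for \<bar>x\<bar> \<ge>
  1.\<close>

lemma bessel_mix_ratio_bounds:
  assumes "b > 0" "x \<noteq> 0"
  shows "\<bar>x\<bar> * bessel_mix (a + 1) b x \<le> (\<bar>a + 1\<bar> + sqrt b) * (1 + 1 / \<bar>x\<bar>) * bessel_mix a b x"
    and "bessel_mix (a + 1) b x \<le> (\<bar>a + 1\<bar> + sqrt b) * (1 + 1 / \<bar>x\<bar>)\<^sup>2 * bessel_mix a b x"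
proof -
  have M: "bessel_mix a b x > 0" using assms by (intro bessel_mix_pos) auto
  have X: "\<bar>x\<bar> > 0" using assms by simp
  have "\<bar>x\<bar> * (\<bar>x\<bar> * bessel_mix (a + 1) b x) \<le> (\<bar>a + 1\<bar> + sqrt b * \<bar>x\<bar>) * bessel_mix a b x"
    using bessel_mix_ratio[OF assms, of a] by (simp add: power2_eq_square mult.assoc[symmetric])
  also have "\<dots> \<le> (\<bar>x\<bar> * ((\<bar>a + 1\<bar> + sqrt b) * (1 + 1 / \<bar>x\<bar>))) * bessel_mix a b x"
    using M X assms(1) by (intro mult_right_mono) (auto simp: field_simps)
  finally show 1: "\<bar>x\<bar> * bessel_mix (a + 1) b x \<le> (\<bar>a + 1\<bar> + sqrt b) * (1 + 1 / \<bar>x\<bar>) * bessel_mix a b x"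
    using X by (simp add: mult.assoc)
  have "bessel_mix (a + 1) b x = 1 / \<bar>x\<bar> * (\<bar>x\<bar> * bessel_mix (a + 1) b x)" using X by simp
  also have "\<dots> \<le> 1 / \<bar>x\<bar> * ((\<bar>a + 1\<bar> + sqrt b) * (1 + 1 / \<bar>x\<bar>) * bessel_mix a b x)"
    by (intro mult_left_mono 1) simp
  also have "\<dots> \<le> (1 + 1 / \<bar>x\<bar>) * ((\<bar>a + 1\<bar> + sqrt b) * (1 + 1 / \<bar>x\<bar>) * bessel_mix a b x)"
    using M assms(1) by (intro mult_right_mono mult_nonneg_nonneg) auto
  finally show "bessel_mix (a + 1) b x \<le> (\<bar>a + 1\<bar> + sqrt b) * (1 + 1 / \<bar>x\<bar>)\<^sup>2 * bessel_mix a b x"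
    by (simp add: power2_eq_square mult_ac)
qed

text \<open>Everything reduces to the ratio of the moments of order a + 1 and a: the recurrence at
  order a + 1 removes the moment of order a + 2 from the second derivative.\<close>

lemma bessel_mix_spectral_profile:
  assumes "b > 0" "m \<ge> 0" "G \<ge> 0"
    and ratio1: "\<And>x. x \<noteq> 0 \<Longrightarrow> \<bar>x\<bar> * bessel_mix (a + 1) b x \<le> G * (1 + m / \<bar>x\<bar>) * bessel_mix a b x"
    and ratio2: "\<And>x. x \<noteq> 0 \<Longrightarrow> bessel_mix (a + 1) b x \<le> G * (1 + m / \<bar>x\<bar>)\<^sup>2 * bessel_mix a b x"
  shows "spectral_profile (bessel_mix a b) (\<lambda>x. - 2 * x * bessel_mix (a + 1) b x)
    (\<lambda>x. - 2 * bessel_mix (a + 1) b x + 4 * x\<^sup>2 * bessel_mix (a + 2) b x)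
    (1 + 2 * G + 4 * \<bar>a + 1\<bar> * G + 4 * b) m"
    (is "spectral_profile _ _ _ ?C _")
proof
  \<comment> \<open>The summand 1 makes the constant at least 1, hence at most its own square; this
    turns the linear bound on the second derivative into the squared one of the locale.\<close>
  have C: "?C \<ge> 1" "2 * G \<le> ?C" "2 * G + 4 * \<bar>a + 1\<bar> * G + 4 * b \<le> ?C"
    using assms(1,3) mult_nonneg_nonneg[of "4 * \<bar>a + 1\<bar>" G] by (simp; linarith)+
  show "?C > 0" using C(1) by linarith
  show "m \<ge> 0" by (rule assms)
  fix x :: real
  show "\<exists>B. \<forall>x. \<delta> \<le> \<bar>x\<bar> \<longrightarrow> bessel_mix a b x \<le> B / (1 + x\<^sup>2)" if "\<delta> > 0" for \<delta>
    using that bessel_mix_decay[of b \<delta> a] assms(1) by auto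
  assume x: "x \<noteq> 0"
  show M: "bessel_mix a b x > 0" using assms(1) x by (intro bessel_mix_pos) auto
  have M1: "bessel_mix (a + 1) b x > 0" using assms(1) x by (intro bessel_mix_pos) auto
  have M2: "bessel_mix (a + 2) b x > 0" using assms(1) x by (intro bessel_mix_pos) auto
  show "(bessel_mix a b has_real_derivative - 2 * x * bessel_mix (a + 1) b x) (at x)"
    using assms(1) x by (intro bessel_mix_has_derivative) auto
  have "(bessel_mix (a + 1) b has_real_derivative - 2 * x * bessel_mix (a + 2) b x) (at x)"
    using bessel_mix_has_derivative[of b x "a + 1"] assms(1) x by (simp add: add.assoc)
  then show "((\<lambda>x. - 2 * x * bessel_mix (a + 1) b x) has_real_derivative
      - 2 * bessel_mix (a + 1) b x + 4 * x\<^sup>2 * bessel_mix (a + 2) b x) (at x)"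
    by (auto intro!: derivative_eq_intros simp: power2_eq_square)
  define t where "t = 1 + m / \<bar>x\<bar>"
  have t: "t \<ge> 1" using assms(2) by (simp add: t_def)
  have "\<bar>- 2 * x * bessel_mix (a + 1) b x\<bar> = 2 * (\<bar>x\<bar> * bessel_mix (a + 1) b x)"
    using M1 by (simp add: abs_mult)
  also have "\<dots> \<le> 2 * G * (t * bessel_mix a b x)" using ratio1[OF x] by (simp add: t_def mult.assoc)
  also have "\<dots> \<le> ?C * (t * bessel_mix a b x)" using C(2) M t by (intro mult_right_mono) auto
  finally show "\<bar>- 2 * x * bessel_mix (a + 1) b x\<bar> \<le> ?C * (1 + m / \<bar>x\<bar>) * bessel_mix a b x"
    by (simp add: t_def mult.assoc)
  have r2: "bessel_mix (a + 1) b x \<le> G * (t\<^sup>2 * bessel_mix a b x)"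
    using ratio2[OF x] by (simp add: t_def mult.assoc)
  have t2: "1 \<le> t\<^sup>2" using t by simp
  have "\<bar>- 2 * bessel_mix (a + 1) b x + 4 * x\<^sup>2 * bessel_mix (a + 2) b x\<bar>
      \<le> 2 * bessel_mix (a + 1) b x + 4 * (x\<^sup>2 * bessel_mix (a + 2) b x)"
    using M1 M2 by (simp add: abs_le_iff)
  also have "x\<^sup>2 * bessel_mix (a + 2) b x = (a + 1) * bessel_mix (a + 1) b x + b * bessel_mix a b x"
    using bessel_mix_recurrence[of b x "a + 1"] assms(1) x by (simp add: add.assoc)
  also have "(a + 1) * bessel_mix (a + 1) b x \<le> \<bar>a + 1\<bar> * (G * (t\<^sup>2 * bessel_mix a b x))"
    using r2 M1 by (intro mult_mono) auto
  also have "b * bessel_mix a b x \<le> b * (t\<^sup>2 * bessel_mix a b x)"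
    using assms(1) M t2 by (intro mult_left_mono) auto
  also note r2
  finally have "\<bar>- 2 * bessel_mix (a + 1) b x + 4 * x\<^sup>2 * bessel_mix (a + 2) b x\<bar> \<le>
      (2 * G + 4 * \<bar>a + 1\<bar> * G + 4 * b) * (t\<^sup>2 * bessel_mix a b x)"
    by (simp add: algebra_simps)
  also have "\<dots> \<le> ?C\<^sup>2 * (t\<^sup>2 * bessel_mix a b x)"
    using order_trans[OF C(3) self_le_power[OF C(1), of 2]] M by (intro mult_right_mono) auto
  finally show "\<bar>- 2 * bessel_mix (a + 1) b x + 4 * x\<^sup>2 * bessel_mix (a + 2) b x\<bar>
      \<le> (?C * (1 + m / \<bar>x\<bar>))\<^sup>2 * bessel_mix a b x"
    by (simp add: t_def power_mult_distrib mult.assoc)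
qed

text \<open>A separate \<open>U\<close> is returned because for a \<ge> 1 the share on the lattice
  involves the divergent integral at 0 and has to be replaced by its limits.\<close>

lemma twice_diff_decaying_share_bessel_mix:
  assumes "b > 0" "a < - 1 \<or> a \<ge> 1"
  obtains U where "twice_diff_decaying U" "\<And>x. x \<notin> lattice \<Longrightarrow> U x = share (bessel_mix a b) {0} x"
    "\<And>x J. x \<notin> lattice \<Longrightarrow> integrable (count_space J) (\<lambda>j. bessel_mix a b (x + 2 * pi * of_int j))"
proof (cases "a \<ge> 1")
  case True
  define A where "A = \<bar>a + 1\<bar> + sqrt b"
  interpret spectral_profile "bessel_mix a b" "\<lambda>x. - 2 * x * bessel_mix (a + 1) b x"
    "\<lambda>x. - 2 * bessel_mix (a + 1) b x + 4 * x\<^sup>2 * bessel_mix (a + 2) b x"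
    "1 + 2 * A + 4 * \<bar>a + 1\<bar> * A + 4 * b" 1
    unfolding A_def using assms(1) bessel_mix_ratio_bounds[OF assms(1)]
    by (intro bessel_mix_spectral_profile) auto
  \<comment> \<open>The recurrence at order a - 1 with its nonnegative first term dropped;
    monotonicity moves the evaluation point to pi.\<close>
  let ?c0 = "b * bessel_mix (a - 2) b pi"
  have c0: "?c0 > 0" using assms(1) by (intro mult_pos_pos bessel_mix_pos) auto
  have "?c0 / x\<^sup>2 \<le> bessel_mix a b x" if x: "x \<noteq> 0" "\<bar>x\<bar> \<le> pi" for x
  proof -
    have "?c0 \<le> b * bessel_mix (a - 2) b x"
      using x assms(1) by (intro mult_left_mono bessel_mix_antimono) auto
    also have "\<dots> \<le> (a - 1) * bessel_mix (a - 1) b x + b * bessel_mix (a - 2) b x"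
      using True bessel_mix_pos[of b x "a - 1"] x assms(1) by simp
    also have "\<dots> = x\<^sup>2 * bessel_mix a b x"
      using bessel_mix_recurrence[of b x "a - 1"] x assms(1) by simp
    finally show ?thesis using x by (simp add: divide_le_eq mult.commute)
  qed
  from twice_diff_decaying_singular[OF c0 this] off_lattice_integrable(1) show ?thesis
    by (intro that[of "\<lambda>x. if x \<in> lattice then of_bool (x = 0) else share (bessel_mix a b) {0} x"]) auto
next
  case False
  then have a: "a < - 1" using assms(2) by auto
  define A where "A = \<bar>a + 1\<bar> + sqrt b"
  define M0 where "M0 = bessel_mix (a + 1) b 0"
  \<comment> \<open>For \<bar>x\<bar> \<ge> 1 the factor 1 + 1/\<bar>x\<bar> is at most 2, which
    gives 4 A. For \<bar>x\<bar> < 1 the numerator is at most its value at 0 and the denominator at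
    least its value at 1.\<close>
  define G where "G = 4 * A + M0 / bessel_mix a b 1"
  have pos: "bessel_mix a b x > 0" "bessel_mix (a + 1) b x > 0" for x
    using a assms(1) by (auto intro!: bessel_mix_pos)
  have M1_le: "bessel_mix (a + 1) b x \<le> M0" for x
    unfolding M0_def using a assms(1) by (intro bessel_mix_antimono) auto
  have A0: "A \<ge> 0" using assms(1) by (simp add: A_def)
  have G: "4 * A \<le> G" "M0 / bessel_mix a b 1 \<le> G" "G \<ge> 0"
    using A0 pos(1)[of 1] pos(2)[of 0] by (auto simp: G_def M0_def)
  have ratio: "\<bar>x\<bar> * bessel_mix (a + 1) b x \<le> G * bessel_mix a b x \<and> bessel_mix (a + 1) b x \<le> G * bessel_mix a b x"
    if x: "x \<noteq> 0" for x
  proof (cases "\<bar>x\<bar> \<ge> 1")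
    case True
    define t where "t = 1 + 1 / \<bar>x\<bar>"
    have t: "0 \<le> t" "t \<le> 2" using True by (auto simp: t_def divide_le_eq)
    have "A * t \<le> A * 4" "A * t\<^sup>2 \<le> A * 2\<^sup>2" using t A0 by (intro mult_left_mono power_mono; simp)+
    then have le: "A * t \<le> G" "A * t\<^sup>2 \<le> G" using G by auto
    show ?thesis
      using bessel_mix_ratio_bounds[OF assms(1) x, of a] mult_right_mono[OF le(1), of "bessel_mix a b x"]
        mult_right_mono[OF le(2), of "bessel_mix a b x"] pos(1)[of x]
      unfolding A_def[symmetric] t_def[symmetric] by linarith
  next
    case False
    have "bessel_mix a b 1 \<le> bessel_mix a b x" using False x assms(1) by (intro bessel_mix_antimono) auto
    have "bessel_mix (a + 1) b x \<le> M0 / bessel_mix a b 1 * bessel_mix a b 1"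
      using M1_le[of x] pos(1)[of 1] by simp
    also have "\<dots> \<le> G * bessel_mix a b x"
      using G pos(1)[of 1] \<open>bessel_mix a b 1 \<le> bessel_mix a b x\<close> by (intro mult_mono) auto
    finally have *: "bessel_mix (a + 1) b x \<le> G * bessel_mix a b x" .
    moreover have "\<bar>x\<bar> * bessel_mix (a + 1) b x \<le> 1 * bessel_mix (a + 1) b x"
      using False pos(2)[of x] by (intro mult_right_mono) auto
    ultimately show ?thesis by auto
  qed
  interpret spectral_profile "bessel_mix a b" "\<lambda>x. - 2 * x * bessel_mix (a + 1) b x"
    "\<lambda>x. - 2 * bessel_mix (a + 1) b x + 4 * x\<^sup>2 * bessel_mix (a + 2) b x"
    "1 + 2 * G + 4 * \<bar>a + 1\<bar> * G + 4 * b" 0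
    using assms(1) G ratio by (intro bessel_mix_spectral_profile) auto
  have "((\<lambda>x. - 2 * x * bessel_mix (a + 1) b x) \<longlongrightarrow> 0) (at 0)"
  proof (rule Lim_null_comparison)
    show "\<forall>\<^sub>F x in at 0. norm (- 2 * x * bessel_mix (a + 1) b x) \<le> 2 * \<bar>x\<bar> * M0"
      using M1_le pos(2) by (intro always_eventually) (auto simp: abs_mult abs_of_pos[OF pos(2)] intro!: mult_left_mono)
    show "((\<lambda>x. 2 * \<bar>x\<bar> * M0) \<longlongrightarrow> 0) (at 0)"
      by (rule tendsto_eq_intros refl | simp)+
  qed
  then have "isCont (\<lambda>x. - 2 * x * bessel_mix (a + 1) b x) 0" by (simp add: isCont_def)
  moreover have "(bessel_mix a b has_real_derivative 0) (at 0)"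
    using bessel_mix_has_derivative[of b 0 a] assms(1) a by simp
  moreover have "bessel_mix a b x \<le> (bessel_mix a b 0 + \<bar>a - 1\<bar> * bessel_mix (a - 1) b 0
      + b * bessel_mix (a - 2) b 0) / (1 + x\<^sup>2)" for x
    using a assms(1) by (intro bessel_mix_decay) auto
  moreover have "bessel_mix a b pi \<le> bessel_mix a b x" if "\<bar>x\<bar> \<le> pi" for x
    using that a assms(1) by (intro bessel_mix_antimono) auto
  ultimately have "twice_diff_decaying (share (bessel_mix a b) {0})"
    by (intro twice_diff_decaying_regular[OF refl pos(1)[of 0] _ _ _ _ pos(1)[of pi]]) auto
  then show ?thesis using off_lattice_integrable(1) by (intro that[of "share (bessel_mix a b) {0}"]) auto
qed

lemma infsum_eq_integral_count_space:
  fixes f :: "'a \<Rightarrow> 'b::{banach, second_countable_topology}"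
  assumes "integrable (count_space A) f"
  shows "f summable_on A" "infsum f A = (LINT x|count_space A. f x)"
proof -
  have "Infinite_Set_Sum.abs_summable_on f A" using assms by (simp add: abs_summable_on_def)
  then show "f summable_on A" "infsum f A = (LINT x|count_space A. f x)"
    by (auto simp: infsetsum_infsum[symmetric] infsetsum_def abs_summable_equivalent[symmetric]
        intro: abs_summable_summable)
qed

lemma fundamental_fun_decay:
  assumes "c > 0" "\<alpha> < - 3 / 2 \<or> \<alpha> \<ge> 1 / 2" "\<alpha> \<notin> \<nat>"
  obtains K where "K \<ge> 0" "\<And>x. norm (fundamental_fun \<alpha> c x) \<le> K / (1 + x\<^sup>2)"
    "fundamental_fun \<alpha> c \<in> borel_measurable borel"
proof -
  define a where "a = \<alpha> + 1 / 2"
  define b where "b = c\<^sup>2 / 4"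
  define w where "w = 2 powr (1 + \<alpha>) / Gamma (- \<alpha>) * 2 powr (\<alpha> - 1 / 2)"
  \<comment> \<open>At a pole \<open>Gamma\<close> takes the default value 0, and division by it
    would make the whole transform vanish; off the poles \<open>w\<close> is nonzero and
    cancels.\<close>
  have "- \<alpha> \<notin> \<int>\<^sub>\<le>\<^sub>0"
  proof
    assume "- \<alpha> \<in> \<int>\<^sub>\<le>\<^sub>0"
    then obtain n :: nat where "- \<alpha> = - of_nat n" by (rule nonpos_Ints_cases')
    then show False using assms(3) by auto
  qed
  then have w: "w \<noteq> 0" by (simp add: w_def Gamma_eq_zero_iff)
  obtain U where U: "twice_diff_decaying U" "\<And>x. x \<notin> lattice \<Longrightarrow> U x = share (bessel_mix a b) {0} x"
    "\<And>x J. x \<notin> lattice \<Longrightarrow> integrable (count_space J) (\<lambda>j. bessel_mix a b (x + 2 * pi * of_int j))"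
    by (rule twice_diff_decaying_share_bessel_mix[of b a]) (use assms in \<open>auto simp: a_def b_def\<close>)
  have quot: "fundamental_quotient \<alpha> c x = U x" if x: "x \<notin> lattice" for x
  proof -
    have hat: "multiquadric_hat \<alpha> c (x + 2 * pi * of_int j) = w * bessel_mix a b (x + 2 * pi * of_int j)" for j
      using multiquadric_hat_eq_bessel_mix[OF assms(1) shift_lattice[OF x]]
      by (simp add: w_def a_def b_def)
    have "(\<Sum>\<^sub>\<infinity>j\<in>UNIV. multiquadric_hat \<alpha> c (x + 2 * pi * of_int j)) = w * periodization UNIV (bessel_mix a b) x"
      unfolding hat periodization_def using infsum_eq_integral_count_space[OF U(3)[OF x, of UNIV]]
      by (simp add: infsum_cmult_right')
    then show ?thesis
      using hat[of 0] w by (simp add: fundamental_quotient_def U(2)[OF x] share_def periodization_singleton)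
  qed
  obtain D E K where bounds: "\<And>x. \<bar>U x\<bar> \<le> K / (1 + x\<^sup>2)" "\<And>x. \<bar>D x\<bar> \<le> K / (1 + x\<^sup>2)" "\<And>x. \<bar>E x\<bar> \<le> K / (1 + x\<^sup>2)"
    and cont: "continuous_on UNIV U" "continuous_on UNIV D"
    and der: "\<And>x. x \<notin> lattice \<Longrightarrow> (U has_real_derivative D x) (at x)"
      "\<And>x. x \<notin> lattice \<Longrightarrow> (D has_real_derivative E x) (at x)"
    using U(1) unfolding twice_diff_decaying_def by blast
  \<comment> \<open>Continuity of \<open>U\<close> identifies the value of \<open>Lim\<close> on the
    lattice, so the two functions agree at every point.\<close>
  have hat: "fundamental_hat \<alpha> c x = U x" for x
  proof (cases "\<exists>k::int. x = 2 * pi * of_int k")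
    case True
    then obtain k :: int where k: "x = 2 * pi * of_int k" by auto
    have "(U \<longlongrightarrow> U x) (at x)" using cont(1) by (simp add: continuous_on_def)
    moreover have "\<forall>\<^sub>F y in at x. U y = fundamental_quotient \<alpha> c y"
    proof -
      have "\<forall>\<^sub>F y in at x. \<bar>y - 2 * pi * of_int k\<bar> < pi \<and> y \<noteq> 2 * pi * of_int k"
        unfolding k by (auto simp: eventually_at dist_real_def intro!: exI[of _ pi])
      then show ?thesis by eventually_elim (rule quot[symmetric], auto dest: near_lattice_point[of _ k])
    qed
    ultimately have "(fundamental_quotient \<alpha> c \<longlongrightarrow> U x) (at x)" by (rule Lim_transform_eventually)
    then show ?thesis using True by (simp add: fundamental_hat_def tendsto_Lim)
  next
    case False
    then have "x \<notin> lattice" by (auto simp: lattice_def)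
    then show ?thesis using False quot by (simp add: fundamental_hat_def)
  qed
  note decay = fourier_integral_decay[OF bounds cont der finite_lattice_Icc]
  show ?thesis
  proof (rule that[of K])
    show "K \<ge> 0" using bounds(1)[of 0] by simp
    show "norm (fundamental_fun \<alpha> c x) \<le> K / (1 + x\<^sup>2)" for x
    proof -
      have "norm (fundamental_fun \<alpha> c x) \<le> 1 / (2 * pi) * (2 * pi * K / (1 + x\<^sup>2))"
        unfolding fundamental_fun_def hat norm_mult
        by (intro mult_mono decay(2)) (auto simp: norm_divide norm_mult)
      then show ?thesis by simp
    qed
    have [measurable]: "U \<in> borel_measurable borel" by (rule borel_measurable_continuous_onI[OF cont(1)])
    show "fundamental_fun \<alpha> c \<in> borel_measurable borel"
      unfolding fundamental_fun_def[abs_def] hat by measurable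
  qed
qed

subsection \<open>Convolution with a decaying kernel\<close>

lemma powr_ge_tangent:
  fixes y m r :: real
  assumes "y \<ge> 0" "m > 0" "r \<ge> 1"
  shows "m powr r + r * m powr (r - 1) * (y - m) \<le> y powr r"
\<comment> \<open>Convexity is applied on the open half-line. At the endpoint the claim collapses to
  (1 - r) m^r \<le> 0.\<close>
proof (cases "y = 0")
  case True
  have "m powr (r - 1) * m = m powr r" using assms(2) by (simp add: powr_mult_base mult.commute)
  then have "m powr r + r * m powr (r - 1) * (y - m) = (1 - r) * m powr r"
    using True by (simp add: algebra_simps)
  also have "\<dots> \<le> 0" using assms(3) by (intro mult_nonpos_nonneg) auto
  finally show ?thesis using powr_ge_zero[of y r] by linarith
next
  case False
  have "r * m powr (r - 1) * (y - m) \<le> y powr r - m powr r"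
  proof (rule convex_on_imp_above_tangent[OF powr_convex[OF assms(3)]])
    show "((\<lambda>x. x powr r) has_real_derivative r * m powr (r - 1)) (at m within {0<..})"
      by (rule has_field_derivative_at_within[OF has_real_derivative_powr[OF assms(2)]])
    show "m \<in> interior {0<..}" using assms(2) by (simp add: interior_open)
  qed (use False assms in auto)
  then show ?thesis by simp
qed

text \<open>The total weight is only bounded by \<open>A\<close>, so the tangent is taken at the
  integral divided by \<open>A\<close>. Its constant term is (1 - r) m^r \<le> 0, and replacing the
  true mass by the larger \<open>A\<close> only lowers the left side.\<close>

lemma Jensen_powr_weighted:
  fixes y w :: "'a \<Rightarrow> real"
  assumes r: "r \<ge> 1" and nonneg: "\<And>j. j \<in> space M \<Longrightarrow> y j \<ge> 0" "\<And>j. j \<in> space M \<Longrightarrow> w j \<ge> 0"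
    and int: "integrable M w" "integrable M (\<lambda>j. y j * w j)" "integrable M (\<lambda>j. y j powr r * w j)"
    and A: "A > 0" "(LINT j|M. w j) \<le> A"
  shows "(LINT j|M. y j * w j) powr r \<le> A powr (r - 1) * (LINT j|M. y j powr r * w j)"
proof -
  define m where "m = (LINT j|M. y j * w j) / A"
  have "0 \<le> (LINT j|M. y j * w j)" using nonneg by (intro Bochner_Integration.integral_nonneg) simp
  then have m0: "m \<ge> 0" using A by (simp add: m_def)
  have eq: "(LINT j|M. y j * w j) = A * m" using A by (simp add: m_def)
  show ?thesis
  proof (cases "m = 0")
    case True
    have "0 \<le> (LINT j|M. y j powr r * w j)" using nonneg by (intro Bochner_Integration.integral_nonneg) simp
    then show ?thesis using True eq by simp
  next
    case False
    with m0 have m: "m > 0" by simp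
    have mm: "m powr (r - 1) * m = m powr r" using m by (simp add: powr_mult_base mult.commute)
    let ?s = "r * m powr (r - 1)"
    have "(LINT j|M. (m powr r - ?s * m) * w j + ?s * (y j * w j)) \<le> (LINT j|M. y j powr r * w j)"
    proof (rule integral_mono)
      fix j assume j: "j \<in> space M"
      show "(m powr r - ?s * m) * w j + ?s * (y j * w j) \<le> y j powr r * w j"
        using mult_right_mono[OF powr_ge_tangent[OF nonneg(1)[OF j] m r] nonneg(2)[OF j]]
        by (simp add: algebra_simps)
    qed (use int in auto)
    then have le: "(m powr r - ?s * m) * (LINT j|M. w j) + ?s * (A * m) \<le> (LINT j|M. y j powr r * w j)"
      using int by (simp add: eq)
    have "A * m powr r = (m powr r - ?s * m) * A + ?s * (A * m)" by (simp add: algebra_simps)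
    also have "\<dots> \<le> (m powr r - ?s * m) * (LINT j|M. w j) + ?s * (A * m)"
    proof (intro add_right_mono mult_left_mono_neg A(2))
      have "(1 - r) * m powr r \<le> 0" using r by (intro mult_nonpos_nonneg) auto
      moreover have e: "?s * m = r * m powr r" by (simp only: mm mult.assoc)
      have "m powr r - ?s * m = (1 - r) * m powr r" unfolding e by (simp add: left_diff_distrib)
      ultimately show "m powr r - ?s * m \<le> 0" by simp
    qed
    also note le
    finally have le': "A * m powr r \<le> (LINT j|M. y j powr r * w j)" .
    have "(A * m) powr r = A powr (r - 1) * (A * m powr r)"
      using A(1) m by (simp add: powr_mult powr_mult_base mult.assoc[symmetric] mult.commute[of _ A])
    also have "\<dots> \<le> A powr (r - 1) * (LINT j|M. y j powr r * w j)"
      using le' by (intro mult_left_mono) auto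
    finally show ?thesis by (simp add: eq)
  qed
qed

lemma Lp_space_finite: "p \<noteq> \<infinity> \<Longrightarrow> f \<in> Lp_space p M \<longleftrightarrow>
    f \<in> borel_measurable M \<and> integrable M (\<lambda>x. norm (f x) powr enn2real p)"
  by (auto simp: Lp_space_def)

text \<open>The embedding of every sequence space into the bounded sequences. Convergence and
  measurability of the series can then be settled for bounded coefficients alone.\<close>

lemma norm_le_Lp_norm_count_space:
  assumes "y \<in> Lp_space p (count_space UNIV)" "1 \<le> p"
  shows "norm (y j) \<le> Lp_norm p (count_space UNIV) y"
proof (cases "p = \<infinity>")
  case True
  let ?e = "esssup (count_space UNIV) (\<lambda>x. ennreal (norm (y x)))"
  have fin: "?e < \<infinity>" using assms(1) True by (simp add: Lp_space_def)
  have "ennreal (norm (y j)) \<le> ?e"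
    using esssup_AE[of "\<lambda>x. ennreal (norm (y x))" "count_space UNIV"] by (simp add: AE_count_space)
  then have "norm (y j) \<le> enn2real ?e"
    using fin by (metis enn2real_ennreal enn2real_mono norm_ge_zero infinity_ennreal_def)
  then show ?thesis using True by (simp add: Lp_norm_def)
next
  case False
  define r where "r = enn2real p"
  have r: "r \<ge> 1" using enn2real_mono[OF assms(2)] False by (simp add: r_def less_top)
  have int: "integrable (count_space UNIV) (\<lambda>x. norm (y x) powr r)"
    using assms(1) False by (simp add: Lp_space_finite r_def)
  have "norm (y j) powr r = (LINT x|count_space UNIV. indicator {j} x * norm (y x) powr r)"
    by (subst lebesgue_integral_count_space_finite_support) (auto simp: indicator_def Collect_conv_if)
  also have "\<dots> \<le> (LINT x|count_space UNIV. norm (y x) powr r)"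
    using integrable_mult_indicator[OF _ int, of "{j}"]
    by (intro integral_mono int) (auto simp: indicator_def)
  finally have "(norm (y j) powr r) powr (1 / r) \<le> (LINT x|count_space UNIV. norm (y x) powr r) powr (1 / r)"
    using r by (intro powr_mono2) auto
  then show ?thesis using r False by (simp add: powr_powr Lp_norm_def r_def)
qed

lemma measurable_pair_count_space:
  fixes f :: "'a \<Rightarrow> 'b::countable \<Rightarrow> 'c"
  assumes [measurable]: "\<And>j. (\<lambda>x. f x j) \<in> measurable M N"
  shows "(\<lambda>(x, j). f x j) \<in> measurable (M \<Otimes>\<^sub>M count_space UNIV) N"
  using measurable_compose_countable[of "\<lambda>j p. f (fst p) j" "M \<Otimes>\<^sub>M count_space UNIV" N snd]
  by (simp add: case_prod_beta)

section \<open>The discrete convolution operator\<close>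

locale decaying_kernel =
  fixes L :: "real \<Rightarrow> complex" and K :: real
  assumes L_measurable [measurable]: "L \<in> borel_measurable borel"
    and K_nonneg: "K \<ge> 0"
    and L_bound: "norm (L x) \<le> K / (1 + x\<^sup>2)"
begin

definition convolution :: "(int \<Rightarrow> complex) \<Rightarrow> real \<Rightarrow> complex" where
  "convolution y x = (\<Sum>\<^sub>\<infinity>j\<in>UNIV. y j * L (x - of_int j))"

text \<open>A bound for the sum of the translated kernel moduli, uniform in x. The added 1 keeps it
  positive when K = 0, since Jensen's inequality divides by it.\<close>

definition A :: real where
  "A = 1 + 4 * K * (LINT j|count_space (UNIV :: int set). 1 / (1 + (of_int j)\<^sup>2))"

lemma A_pos: "A > 0"
  unfolding A_def using K_nonneg
  by (intro add_pos_nonneg mult_nonneg_nonneg Bochner_Integration.integral_nonneg) auto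

lemma weights:
  shows "integrable (count_space UNIV) (\<lambda>j::int. norm (L (x - of_int j)))"
    and "(LINT j|count_space (UNIV :: int set). norm (L (x - of_int j))) \<le> A"
proof -
  \<comment> \<open>Reindexing by the integer part leaves a shift s in [0, 1], for which the Peetre
    factor 2 (1 + s^2) is at most 4. Hence the bound is independent of x.\<close>
  define n where "n = \<lfloor>x\<rfloor>"
  define g where "g j = 4 * K * (1 / (1 + (real_of_int (n - j))\<^sup>2))" for j
  have bij: "bij_betw (\<lambda>j::int. n - j) UNIV UNIV"
    by (rule bij_betwI[where g = "\<lambda>j. n - j"]) auto
  have gi: "integrable (count_space UNIV) g"
    unfolding g_def
    using integrable_bij_count_space[OF bij, of "\<lambda>i. 1 / (1 + (real_of_int i)\<^sup>2)"]
      integrable_count_space_int_one_div_one_plus_square[of UNIV] by (intro integrable_mult_right) simp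
  have "(LINT j|count_space UNIV. g j) = A - 1"
    unfolding g_def A_def
    by (simp only: integral_mult_right_zero integral_bij_count_space[OF bij, of "\<lambda>i. 1 / (1 + (real_of_int i)\<^sup>2)"])
  then have gI: "(LINT j|count_space UNIV. g j) \<le> A" by simp
  have le: "norm (L (x - of_int j)) \<le> g j" for j
  proof -
    define s where "s = x - of_int n"
    have s: "0 \<le> s" "s \<le> 1" unfolding s_def n_def by linarith+
    have "norm (L (x - of_int j)) \<le> K * (1 / (1 + (s + of_int (n - j))\<^sup>2))"
      using L_bound[of "x - of_int j"] by (simp add: s_def)
    also have "\<dots> \<le> K * (2 * (1 + s\<^sup>2) * (1 / (1 + (of_int (n - j))\<^sup>2)))"
      by (intro mult_left_mono one_div_one_plus_square_shift K_nonneg)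
    also have "\<dots> \<le> K * (2 * (1 + 1) * (1 / (1 + (of_int (n - j))\<^sup>2)))"
      using s by (intro mult_left_mono mult_right_mono add_left_mono K_nonneg) (auto simp: power_le_one)
    finally show ?thesis by (simp add: g_def mult.commute)
  qed
  show i: "integrable (count_space UNIV) (\<lambda>j::int. norm (L (x - of_int j)))"
    by (rule Bochner_Integration.integrable_bound[OF gi]) (use le in \<open>auto intro: order_trans[OF _ abs_ge_self]\<close>)
  have "(LINT j|count_space (UNIV :: int set). norm (L (x - of_int j))) \<le> (LINT j|count_space UNIV. g j)"
    by (rule integral_mono[OF i gi]) (use le in simp)
  with gI show "(LINT j|count_space (UNIV :: int set). norm (L (x - of_int j))) \<le> A" by simp
qed

lemma weighted_integrable:
  fixes f :: "int \<Rightarrow> real"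
  assumes "\<And>j. \<bar>f j\<bar> \<le> Y"
  shows "integrable (count_space UNIV) (\<lambda>j::int. f j * norm (L (x - of_int j)))"
  by (rule Bochner_Integration.integrable_bound[OF integrable_mult_right[OF weights(1), of Y x]])
    (use assms[THEN order_trans[OF _ abs_ge_self]] in \<open>auto simp: abs_mult intro!: mult_right_mono\<close>)

lemma convolution_integrable:
  assumes "\<forall>j. norm (y j) \<le> Y"
  shows "integrable (count_space UNIV) (\<lambda>j. y j * L (x - of_int j))"
  by (rule Bochner_Integration.integrable_bound[OF weighted_integrable[of "\<lambda>j. norm (y j)" Y x]])
    (use assms in \<open>auto simp: norm_mult\<close>)

lemma convolution_eq:
  assumes "\<forall>j. norm (y j) \<le> Y"
  shows "convolution y x = (LINT j|count_space UNIV. y j * L (x - of_int j))"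
  unfolding convolution_def by (rule infsum_eq_integral_count_space(2)[OF convolution_integrable[OF assms]])

lemma convolution_measurable:
  assumes "\<forall>j. norm (y j) \<le> Y"
  shows "convolution y \<in> borel_measurable borel"
proof -
  have eq: "convolution y = (\<lambda>x. LINT j|count_space UNIV. y j * L (x - of_int j))"
    using convolution_eq[OF assms] by blast
  interpret sigma_finite_measure "count_space (UNIV :: int set)"
    by (rule sigma_finite_measure_count_space_countable) simp
  have "(\<lambda>(x, j). y j * L (x - of_int j)) \<in> borel_measurable (borel \<Otimes>\<^sub>M count_space UNIV)"
    by (rule measurable_pair_count_space) simp_all
  then show ?thesis unfolding eq by (rule borel_measurable_lebesgue_integral)
qed

lemma norm_convolution_le:
  assumes "\<forall>j. norm (y j) \<le> Y"
  shows "norm (convolution y x) \<le> (LINT j|count_space UNIV. norm (y j) * norm (L (x - of_int j)))"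
  unfolding convolution_eq[OF assms]
  using integral_norm_bound[of "count_space UNIV" "\<lambda>j. y j * L (x - of_int j)"] by (simp add: norm_mult)

lemma nn_integral_L_shift: "(\<integral>\<^sup>+x. ennreal (norm (L (x - of_int j))) \<partial>lborel) \<le> ennreal (K * pi)"
proof -
  have "(\<integral>\<^sup>+x. ennreal (norm (L (x - of_int j))) \<partial>lborel) = (\<integral>\<^sup>+x. ennreal (norm (L x)) \<partial>lborel)"
    by (subst nn_integral_real_affine[where c = 1 and t = "of_int j"]) auto
  also have "\<dots> \<le> (\<integral>\<^sup>+x. ennreal (K * (1 / (1 + x\<^sup>2))) \<partial>lborel)"
    using L_bound by (intro nn_integral_mono ennreal_leI) simp
  also have "\<dots> = ennreal (LINT x|lborel. K * (1 / (1 + x\<^sup>2)))"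
    using K_nonneg
    by (intro nn_integral_eq_integral integrable_mult_right integrable_one_div_one_plus_square AE_I2 mult_nonneg_nonneg) auto
  also have "(LINT x|lborel. K * (1 / (1 + x\<^sup>2))) = K * pi"
    by (simp only: integral_mult_right_zero integral_one_div_one_plus_square)
  finally show ?thesis .
qed

text \<open>A Schur-type argument: the sum over j of the weights enters through Jensen as a power of
  \<open>A\<close>, and the integral over x through Tonelli as \<open>K * pi\<close>. Nonnegative
  integrals are used since integrability of the left side is a consequence.\<close>

lemma nn_integral_convolution_powr:
  fixes y :: "int \<Rightarrow> complex"
  assumes r: "r \<ge> 1" and y: "\<forall>j. norm (y j) \<le> Y"
    and int: "integrable (count_space UNIV) (\<lambda>j. norm (y j) powr r)"
  shows "(\<integral>\<^sup>+x. ennreal (norm (convolution y x) powr r) \<partial>lborel)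
    \<le> ennreal (A powr (r - 1) * (K * pi) * (LINT j|count_space UNIV. norm (y j) powr r))"
proof -
  interpret P: pair_sigma_finite lborel "count_space (UNIV :: int set)"
    by (intro pair_sigma_finite.intro sigma_finite_lborel sigma_finite_measure_count_space_countable) simp
  define h where "h j x = A powr (r - 1) * (norm (y j) powr r * norm (L (x - of_int j)))" for j x
  have hi: "integrable (count_space UNIV) (\<lambda>j. h j x)" for x
    unfolding h_def using powr_mono2[of r "norm (y _)" Y] y r
    by (intro integrable_mult_right weighted_integrable[of _ "Y powr r"]) auto
  have h0: "h j x \<ge> 0" for j x by (simp add: h_def)
  have "(\<integral>\<^sup>+x. ennreal (norm (convolution y x) powr r) \<partial>lborel)
      \<le> (\<integral>\<^sup>+x. (\<integral>\<^sup>+j. ennreal (h j x) \<partial>count_space UNIV) \<partial>lborel)"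
  proof (rule nn_integral_mono)
    fix x
    have "norm (convolution y x) powr r \<le> (LINT j|count_space UNIV. norm (y j) * norm (L (x - of_int j))) powr r"
      using r norm_convolution_le[OF y] by (intro powr_mono2) auto
    also have "\<dots> \<le> A powr (r - 1) * (LINT j|count_space UNIV. norm (y j) powr r * norm (L (x - of_int j)))"
      using r y powr_mono2[of r "norm (y _)" Y]
      by (intro Jensen_powr_weighted weights weighted_integrable[of _ Y] weighted_integrable[of _ "Y powr r"] A_pos) auto
    also have "\<dots> = (LINT j|count_space UNIV. h j x)"
      unfolding h_def by (simp only: integral_mult_right_zero)
    finally have "ennreal (norm (convolution y x) powr r) \<le> ennreal (LINT j|count_space UNIV. h j x)"
      by (rule ennreal_leI)
    also have "\<dots> = (\<integral>\<^sup>+j. ennreal (h j x) \<partial>count_space UNIV)"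
      using hi h0 by (intro nn_integral_eq_integral[symmetric]) auto
    finally show "ennreal (norm (convolution y x) powr r) \<le> (\<integral>\<^sup>+j. ennreal (h j x) \<partial>count_space UNIV)" .
  qed
  also have "\<dots> = (\<integral>\<^sup>+j. (\<integral>\<^sup>+x. ennreal (h j x) \<partial>lborel) \<partial>count_space UNIV)"
  proof (rule P.Fubini'[symmetric])
    show "(\<lambda>(x, j). ennreal (h j x)) \<in> borel_measurable (lborel \<Otimes>\<^sub>M count_space UNIV)"
      by (rule measurable_pair_count_space) (simp_all add: h_def)
  qed
  also have "\<dots> \<le> (\<integral>\<^sup>+j. ennreal (A powr (r - 1) * (K * pi) * norm (y j) powr r) \<partial>count_space UNIV)"
  proof (rule nn_integral_mono)
    fix j
    have "(\<integral>\<^sup>+x. ennreal (h j x) \<partial>lborel)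
        = ennreal (A powr (r - 1) * norm (y j) powr r) * (\<integral>\<^sup>+x. ennreal (norm (L (x - of_int j))) \<partial>lborel)"
      unfolding h_def by (subst nn_integral_cmult[symmetric]) (auto simp: ennreal_mult[symmetric] mult.assoc)
    also have "\<dots> \<le> ennreal (A powr (r - 1) * norm (y j) powr r) * ennreal (K * pi)"
      by (intro mult_left_mono nn_integral_L_shift) simp
    also have "\<dots> = ennreal (A powr (r - 1) * (K * pi) * norm (y j) powr r)"
      using K_nonneg by (simp add: ennreal_mult[symmetric] mult_ac)
    finally show "(\<integral>\<^sup>+x. ennreal (h j x) \<partial>lborel) \<le> ennreal (A powr (r - 1) * (K * pi) * norm (y j) powr r)" .
  qed
  also have "\<dots> = ennreal (LINT j|count_space UNIV. A powr (r - 1) * (K * pi) * norm (y j) powr r)"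
    using K_nonneg by (intro nn_integral_eq_integral integrable_mult_right int) auto
  finally show ?thesis by (simp only: integral_mult_right_zero)
qed

lemma convolution_bounded_infinity:
  assumes y: "y \<in> Lp_space \<infinity> (count_space UNIV)"
  shows "convolution y \<in> Lp_space \<infinity> lborel"
    and "Lp_norm \<infinity> lborel (convolution y) \<le> A * Lp_norm \<infinity> (count_space UNIV) y"
proof -
  define Y where "Y = Lp_norm \<infinity> (count_space UNIV) y"
  have Y: "\<forall>j. norm (y j) \<le> Y"
    unfolding Y_def by (intro allI norm_le_Lp_norm_count_space[OF y]) simp
  have Y0: "Y \<ge> 0" using Y norm_ge_zero order_trans by blast
  note meas = convolution_measurable[OF Y]
  have le: "norm (convolution y x) \<le> A * Y" for x
  proof -
    have "norm (convolution y x) \<le> (LINT j|count_space UNIV. norm (y j) * norm (L (x - of_int j)))"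
      by (rule norm_convolution_le[OF Y])
    also have "\<dots> \<le> (LINT j|count_space UNIV. Y * norm (L (x - of_int j)))"
      using Y by (intro integral_mono weighted_integrable[of _ Y] integrable_mult_right weights mult_right_mono) auto
    also have "\<dots> \<le> Y * A" using Y0 weights(2) by (simp add: mult_left_mono)
    finally show ?thesis by (simp add: mult.commute)
  qed
  have "esssup lborel (\<lambda>x. ennreal (norm (convolution y x))) \<le> ennreal (A * Y)"
    using meas le by (intro esssup_I AE_I2 ennreal_leI) auto
  then show "convolution y \<in> Lp_space \<infinity> lborel"
    and "Lp_norm \<infinity> lborel (convolution y) \<le> A * Lp_norm \<infinity> (count_space UNIV) y"
    using meas A_pos Y0 enn2real_mono[of _ "ennreal (A * Y)"]
    unfolding Y_def[symmetric]
    by (auto simp: Lp_space_def Lp_norm_def le_less_trans[OF _ ennreal_less_top])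
qed

lemma convolution_bounded_finite:
  assumes y: "y \<in> Lp_space p (count_space UNIV)" and p: "1 \<le> p" "p \<noteq> \<infinity>"
  shows "convolution y \<in> Lp_space p lborel"
    and "Lp_norm p lborel (convolution y)
      \<le> (A powr (enn2real p - 1) * (K * pi)) powr (1 / enn2real p) * Lp_norm p (count_space UNIV) y"
proof -
  define r where "r = enn2real p"
  have r: "r \<ge> 1" using enn2real_mono[OF p(1)] p(2) by (simp add: r_def less_top)
  have Y: "\<forall>j. norm (y j) \<le> Lp_norm p (count_space UNIV) y"
    using norm_le_Lp_norm_count_space[OF y p(1)] by blast
  note meas = convolution_measurable[OF Y]
  have int: "integrable (count_space UNIV) (\<lambda>j. norm (y j) powr r)"
    using y p by (simp add: Lp_space_finite r_def)
  let ?N = "LINT j|count_space UNIV. norm (y j) powr r"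
  let ?c = "A powr (r - 1) * (K * pi)"
  have N0: "?N \<ge> 0" by (intro Bochner_Integration.integral_nonneg) simp
  have c0: "?c \<ge> 0" using K_nonneg by simp
  note le = nn_integral_convolution_powr[OF r Y int]
  have m: "(\<lambda>x. norm (convolution y x) powr r) \<in> borel_measurable lborel" using meas by measurable
  show "convolution y \<in> Lp_space p lborel"
    unfolding Lp_space_finite[OF p(2)] r_def[symmetric]
    using meas m le_less_trans[OF le ennreal_less_top] by (auto intro!: integrableI_bounded)
  have "(LINT x|lborel. norm (convolution y x) powr r) \<le> ?c * ?N"
    using enn2real_mono[OF le] c0 N0 m by (simp add: integral_eq_nn_integral)
  then have "(LINT x|lborel. norm (convolution y x) powr r) powr (1 / r) \<le> (?c * ?N) powr (1 / r)"
    using r by (intro powr_mono2 Bochner_Integration.integral_nonneg) auto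
  also have "\<dots> = ?c powr (1 / r) * ?N powr (1 / r)" by (rule powr_mult)
  finally show "Lp_norm p lborel (convolution y)
      \<le> (A powr (enn2real p - 1) * (K * pi)) powr (1 / enn2real p) * Lp_norm p (count_space UNIV) y"
    using p(2) by (simp add: Lp_norm_def r_def)
qed

lemma convolution_summable:
  assumes "y \<in> Lp_space p (count_space UNIV)" "1 \<le> p"
  shows "(\<lambda>j. y j * L (x - of_int j)) summable_on UNIV"
  using norm_le_Lp_norm_count_space[OF assms]
  by (intro infsum_eq_integral_count_space(1) convolution_integrable allI)

lemma bounded_linear_convolution:
  assumes p: "1 \<le> p"
  shows "bounded_linear_Lp p (count_space UNIV) lborel convolution"
  unfolding bounded_linear_Lp_def
proof (intro conjI ballI allI)
  note summable = convolution_summable[OF _ p]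
  show "AE x in lborel. convolution (\<lambda>t. f t + g t) x = convolution f x + convolution g x"
    if "f \<in> Lp_space p (count_space UNIV)" "g \<in> Lp_space p (count_space UNIV)" for f g
    unfolding convolution_def distrib_right by (intro AE_I2 infsum_add summable that)
  show "AE x in lborel. convolution (\<lambda>t. a * f t) x = a * convolution f x" for a f
    unfolding convolution_def by (simp add: mult.assoc infsum_cmult_right')
  show "convolution f \<in> Lp_space p lborel" if "f \<in> Lp_space p (count_space UNIV)" for f
    using convolution_bounded_infinity(1) convolution_bounded_finite(1) that p by (cases "p = \<infinity>") auto
  show "\<exists>C. \<forall>f\<in>Lp_space p (count_space UNIV).
      Lp_norm p lborel (convolution f) \<le> C * Lp_norm p (count_space UNIV) f"
  proof (cases "p = \<infinity>")
    case True
    then show ?thesis using convolution_bounded_infinity(2) by blast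
  next
    case False
    then show ?thesis using convolution_bounded_finite(2)[OF _ p] by blast
  qed
qed

end

text \<open>As \<open>infsum\<close> is 0 for families that are not summable, the first conjunct
  certifies that the operator is given by a genuinely convergent series at every point.\<close>

theorem theorem21:
  fixes \<alpha> c :: real and p :: ennreal
  assumes "\<alpha> \<in> {..< -3/2} \<union> ({1/2..} - \<nat>)"
    and "c > 0"
    and "1 \<le> p"
  shows "(\<forall>y \<in> Lp_space p (count_space (UNIV :: int set)). \<forall>x.
            (\<lambda>j. y j * fundamental_fun \<alpha> c (x - of_int j)) summable_on UNIV)
       \<and> bounded_linear_Lp p (count_space (UNIV :: int set)) lborel (cardinal_interpolation \<alpha> c)"
proof -
  have \<alpha>: "\<alpha> < - 3 / 2 \<or> \<alpha> \<ge> 1 / 2" "\<alpha> \<notin> \<nat>"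
    using assms(1) by (auto elim!: Nats_cases)
  obtain K where "K \<ge> 0" "\<And>x. norm (fundamental_fun \<alpha> c x) \<le> K / (1 + x\<^sup>2)"
    "fundamental_fun \<alpha> c \<in> borel_measurable borel"
    using fundamental_fun_decay[OF assms(2) \<alpha>] by blast
  then interpret decaying_kernel "fundamental_fun \<alpha> c" K by unfold_locales
  have "cardinal_interpolation \<alpha> c = convolution"
    by (intro ext) (simp add: cardinal_interpolation_def convolution_def)
  then show ?thesis using bounded_linear_convolution[OF assms(3)] convolution_summable[OF _ assms(3)] by simp
qed

end
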